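(* Let $k<n$, $m=n(1-1/k)$, $\bar h_n(z)=\mathbb E[h_n(z,Z_{1:m})]$ and $\sigma_n^2=\operatorname{Var}(\bar h_n(Z_0))\in(0,\infty)$, and define the within-fold variance estimator $$\hat\sigma_{n,in}^2=\frac1k\sum_{j=1}^k\frac{1}{(n/k)-1}\sum_{i\in B_j'}\Big(h_n(Z_i,Z_{B_j})-\frac kn\sum_{i'\in B_j'}h_n(Z_{i'},Z_{B_j})\Big)^2.$$ Suppose $(Z_i)_{i\ge1}$ are i.i.d. copies of a random element $Z_0$. Then: (1) $\hat\sigma_{n,in}^2/\sigma_n^2\to1$ in $L^1$ as $n\to\infty$ whenever $\gamma_{loss}(h_n)=o(\sigma_n^2/n)$ and the sequence $\big((\bar h_n(Z_0)-\mathbb E[\bar h_n(Z_0)])^2/\sigma_n^2\big)_n$ is uniformly integrable. (2) $\hat\sigma_{n,in}^2/\sigma_n^2\to1$ in $L^2$ as $n\to\infty$ whenever $\mathbb E\big[\big((\bar h_n(Z_0)-\mathbb E[\bar h_n(Z_0)])/\sigma_n\big)^4\big]=o(n)$ and the fourth-moment loss stability $$\gamma_4(h_n')=\frac1m\sum_{i=1}^m\mathbb E\big[(h_n'(Z_0,Z_{1:m})-h_n'(Z_0,Z_{1:m}^{\backslash i}))^4\big]$$ satisfies $\gamma_4(h_n')=o(\sigma_n^4/n^2)$.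
   Context: $(Z_i)_{i\ge1}$ is a sequence of random elements of a (measurable) set $\mathcal Z$. For each sample size $n$, $k=k_n\ge 2$ is a number of folds, possibly depending on $n$, which divides $n$ evenly, and $\{(B_j,B_j')\}_{j=1}^k$ are (non-random) train-validation splits: $B_j$ and $B_j'$ are vectors of distinct indices in $[n]=\{1,\dots,n\}$ which together partition $[n]$, and the validation index vectors $B_1',\dots,B_k'$ partition $[n]$ into $k$ folds of size $n/k$; each $B_j$ has length $m=n(1-1/k)$. For a vector $B$ of indices, $Z_B$ is the subvector of $Z_{1:n}=(Z_1,\dots,Z_n)$ with the ordered indices in $B$. $h_n:\mathcal Z\times\mathcal Z^m\to\mathbb R$ is a (measurable) loss function (not assumed symmetric in the training points), and all expectations that appear are assumed to be well defined. $Z_{1:m}^{\backslash i}$ denotes $Z_{1:m}$ with $Z_i$ replaced by an identically distributed copy independent of $Z_{0:m}=(Z_0,\dots,Z_m)$. For $h:\mathcal Z\times\mathcal Z^m\to\mathbb R$, the mean-square stability is $\gamma_{ms}(h)=\frac1m\sum_{i=1}^m\mathbb E[(h(Z_0,Z_{1:m})-h(Z_0,Z_{1:m}^{\backslash i}))^2]$, and the loss stability is $\gamma_{loss}(h)=\gamma_{ms}(h')$, where $h'(Z_0,Z_{1:m})=h(Z_0,Z_{1:m})-\mathbb E[h(Z_0,Z_{1:m})\mid Z_{1:m}]$; $h_n'$ is obtained from $h_n$ in this way. *)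

theory Defs
  imports "HOL-Probability.Probability"
begin

text \<open>
  Conventions. The observation space is a measurable space \<open>N\<close>; \<open>Z 0, Z 1, Z 2, \<dots>\<close> are random
  elements of \<open>N\<close> on a probability space \<open>M\<close>. An element of the \<open>m\<close>-fold product is an extensional
  function on \<open>{1..m}\<close>, i.e. a point of \<open>\<Pi>\<^sub>M l\<in>{1..m}. N\<close>. Index vectors are lists.
  Expectations of nonnegative variables that may be infinite are \<open>ennreal\<close>-valued, since the
  Bochner integral of a non-integrable function is 0 and would make a smallness assumption
  hold spuriously.
\<close>

definition train_size :: "nat \<Rightarrow> nat \<Rightarrow> nat"
  where "train_size n k = n - n div k"

lemma real_train_size:
  assumes "k dvd n" "k > 0"
  shows "real (train_size n k) = real n * (1 - 1 / real k)"
  using assms by (auto simp: train_size_def of_nat_diff real_of_nat_div field_simps)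

definition cv_splits :: "nat \<Rightarrow> nat \<Rightarrow> (nat \<Rightarrow> nat list) \<Rightarrow> (nat \<Rightarrow> nat list) \<Rightarrow> bool"
  where "cv_splits n k B B' \<longleftrightarrow>
    (\<forall>j\<in>{1..k}. distinct (B j) \<and> distinct (B' j)
        \<and> length (B j) = train_size n k \<and> length (B' j) = n div k
        \<and> set (B j) \<inter> set (B' j) = {} \<and> set (B j) \<union> set (B' j) = {1..n})
    \<and> disjoint_family_on (\<lambda>j. set (B' j)) {1..k}
    \<and> (\<Union>j\<in>{1..k}. set (B' j)) = {1..n}"

definition subvec :: "(nat \<Rightarrow> 'w \<Rightarrow> 'z) \<Rightarrow> nat list \<Rightarrow> 'w \<Rightarrow> nat \<Rightarrow> 'z"
  where "subvec Z b \<omega> = (\<lambda>l\<in>{1..length b}. Z (b ! (l - 1)) \<omega>)"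

definition initvec :: "(nat \<Rightarrow> 'w \<Rightarrow> 'z) \<Rightarrow> nat \<Rightarrow> 'w \<Rightarrow> nat \<Rightarrow> 'z"
  where "initvec Z m \<omega> = (\<lambda>l\<in>{1..m}. Z l \<omega>)"

lemma initvec_eq_subvec: "initvec Z m = subvec Z [1..<Suc m]"
  by (auto simp: initvec_def subvec_def fun_eq_iff restrict_def nth_upt simp del: upt_Suc)

definition mean_loss ::
  "'w measure \<Rightarrow> (nat \<Rightarrow> 'w \<Rightarrow> 'z) \<Rightarrow> nat \<Rightarrow> ('z \<Rightarrow> (nat \<Rightarrow> 'z) \<Rightarrow> real) \<Rightarrow> 'z \<Rightarrow> real"
  where "mean_loss M Z m h z = (LINT \<omega>|M. h z (initvec Z m \<omega>))"

definition within_fold_var ::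
  "(nat \<Rightarrow> 'w \<Rightarrow> 'z) \<Rightarrow> nat \<Rightarrow> nat \<Rightarrow> (nat \<Rightarrow> nat list) \<Rightarrow> (nat \<Rightarrow> nat list) \<Rightarrow>
    ('z \<Rightarrow> (nat \<Rightarrow> 'z) \<Rightarrow> real) \<Rightarrow> 'w \<Rightarrow> real"
  where "within_fold_var Z n k B B' h \<omega> =
    (1 / real k) * (\<Sum>j\<in>{1..k}. (1 / (real n / real k - 1)) *
      (\<Sum>i\<in>set (B' j). (h (Z i \<omega>) (subvec Z (B j) \<omega>)
        - (real k / real n) * (\<Sum>i'\<in>set (B' j). h (Z i' \<omega>) (subvec Z (B j) \<omega>)))\<^sup>2))"

text \<open>
  For i.i.d. \<open>Z\<close>, the variable \<open>Z (Suc m)\<close> is an identically distributed copy of \<open>Z i\<close> that is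
  independent of \<open>Z 0, \<dots>, Z m\<close>. The stabilities depend only on the joint law, hence not on which
  such copy is used.
\<close>

definition replaced :: "(nat \<Rightarrow> 'w \<Rightarrow> 'z) \<Rightarrow> nat \<Rightarrow> nat \<Rightarrow> 'w \<Rightarrow> nat \<Rightarrow> 'z"
  where "replaced Z m i \<omega> = (initvec Z m \<omega>)(i := Z (Suc m) \<omega>)"

definition gamma_ms ::
  "'w measure \<Rightarrow> (nat \<Rightarrow> 'w \<Rightarrow> 'z) \<Rightarrow> nat \<Rightarrow> ('z \<Rightarrow> (nat \<Rightarrow> 'z) \<Rightarrow> real) \<Rightarrow> ennreal"
  where "gamma_ms M Z m h =
    (\<Sum>i\<in>{1..m}. \<integral>\<^sup>+\<omega>. ennreal ((h (Z 0 \<omega>) (initvec Z m \<omega>) - h (Z 0 \<omega>) (replaced Z m i \<omega>)) ^ 2) \<partial>M)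
      / of_nat m"

definition gamma_4 ::
  "'w measure \<Rightarrow> (nat \<Rightarrow> 'w \<Rightarrow> 'z) \<Rightarrow> nat \<Rightarrow> ('z \<Rightarrow> (nat \<Rightarrow> 'z) \<Rightarrow> real) \<Rightarrow> ennreal"
  where "gamma_4 M Z m h =
    (\<Sum>i\<in>{1..m}. \<integral>\<^sup>+\<omega>. ennreal ((h (Z 0 \<omega>) (initvec Z m \<omega>) - h (Z 0 \<omega>) (replaced Z m i \<omega>)) ^ 4) \<partial>M)
      / of_nat m"

text \<open>
  \<open>h'\<close> is evaluated at the replaced training vector as well, so the conditional expectation
  \<open>E[h(Z\<^sub>0, Z\<^sub>1\<^sub>:\<^sub>m) | Z\<^sub>1\<^sub>:\<^sub>m]\<close> is needed in factorized form, as a measurable function of the training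
  vector. Versions agree almost everywhere with respect to the law of \<open>Z\<^sub>1\<^sub>:\<^sub>m\<close>, which is also the
  law of the replaced vector, so the stabilities do not depend on the chosen version.
\<close>

definition is_cond_risk ::
  "'w measure \<Rightarrow> 'z measure \<Rightarrow> (nat \<Rightarrow> 'w \<Rightarrow> 'z) \<Rightarrow> nat \<Rightarrow> ('z \<Rightarrow> (nat \<Rightarrow> 'z) \<Rightarrow> real) \<Rightarrow>
    ((nat \<Rightarrow> 'z) \<Rightarrow> real) \<Rightarrow> bool"
  where "is_cond_risk M N Z m h g \<longleftrightarrow>
    g \<in> borel_measurable (\<Pi>\<^sub>M l\<in>{1..m}. N) \<and>
    (AE \<omega> in M. g (initvec Z m \<omega>) =
      real_cond_exp M (vimage_algebra (space M) (initvec Z m) (\<Pi>\<^sub>M l\<in>{1..m}. N))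
        (\<lambda>\<omega>. h (Z 0 \<omega>) (initvec Z m \<omega>)) \<omega>)"

definition cond_risk ::
  "'w measure \<Rightarrow> 'z measure \<Rightarrow> (nat \<Rightarrow> 'w \<Rightarrow> 'z) \<Rightarrow> nat \<Rightarrow> ('z \<Rightarrow> (nat \<Rightarrow> 'z) \<Rightarrow> real) \<Rightarrow>
    (nat \<Rightarrow> 'z) \<Rightarrow> real"
  where "cond_risk M N Z m h = (SOME g. is_cond_risk M N Z m h g)"

definition centred_loss ::
  "'w measure \<Rightarrow> 'z measure \<Rightarrow> (nat \<Rightarrow> 'w \<Rightarrow> 'z) \<Rightarrow> nat \<Rightarrow> ('z \<Rightarrow> (nat \<Rightarrow> 'z) \<Rightarrow> real) \<Rightarrow>
    'z \<Rightarrow> (nat \<Rightarrow> 'z) \<Rightarrow> real"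
  where "centred_loss M N Z m h z w = h z w - cond_risk M N Z m h w"

definition gamma_loss ::
  "'w measure \<Rightarrow> 'z measure \<Rightarrow> (nat \<Rightarrow> 'w \<Rightarrow> 'z) \<Rightarrow> nat \<Rightarrow> ('z \<Rightarrow> (nat \<Rightarrow> 'z) \<Rightarrow> real) \<Rightarrow> ennreal"
  where "gamma_loss M N Z m h = gamma_ms M Z m (centred_loss M N Z m h)"

text \<open>The choice in \<^const>\<open>cond_risk\<close> is never vacuous for independent data and integrable loss.\<close>

lemma is_cond_risk_integral:
  fixes Z :: "nat \<Rightarrow> 'w \<Rightarrow> 'z" and h :: "'z \<Rightarrow> (nat \<Rightarrow> 'z) \<Rightarrow> real"
  assumes "prob_space M"
    and ind: "prob_space.indep_vars M (\<lambda>_. N) Z UNIV"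
    and meas: "(\<lambda>(z, w). h z w) \<in> borel_measurable (N \<Otimes>\<^sub>M (\<Pi>\<^sub>M l\<in>{1..m}. N))"
    and int: "integrable M (\<lambda>\<omega>. h (Z 0 \<omega>) (initvec Z m \<omega>))"
  shows "is_cond_risk M N Z m h (\<lambda>w. LINT \<omega>|M. h (Z 0 \<omega>) w)"
proof -
  interpret prob_space M by fact
  let ?P = "\<Pi>\<^sub>M l\<in>{1..m}. N"
  let ?V = "initvec Z m"
  let ?g = "\<lambda>w. LINT \<omega>|M. h (Z 0 \<omega>) w"
  let ?F = "vimage_algebra (space M) ?V ?P"
  have Z[measurable]: "\<And>i. Z i \<in> measurable M N"
    using ind by (auto simp: indep_vars_def)
  have V[measurable]: "?V \<in> measurable M ?P"
    unfolding initvec_def[abs_def] by (intro measurable_restrict Z)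
  have h[measurable (raw)]: "(\<lambda>x. h (f x) (v x)) \<in> borel_measurable L"
    if "f \<in> measurable L N" "v \<in> measurable L ?P" for f v and L :: "'x measure"
    using measurable_compose[OF measurable_Pair[OF that] meas] by simp
  have gm[measurable]: "?g \<in> borel_measurable ?P"
    by (rule borel_measurable_lebesgue_integral)
      (use measurable_compose[OF measurable_Pair[OF
          measurable_compose[OF measurable_snd Z[of 0]] measurable_fst] meas]
       in \<open>simp add: case_prod_beta\<close>)
  define P1 where "P1 = distr M N (Z 0)"
  define P2 where "P2 = distr M ?P ?V"
  interpret P1: prob_space P1 unfolding P1_def by (rule prob_space_distr) simp
  interpret P2: prob_space P2 unfolding P2_def by (rule prob_space_distr[OF V])
  interpret PP: pair_prob_space P1 P2 ..
  have iv: "indep_var (PiM {0} (\<lambda>_. N)) (\<lambda>\<omega>. restrict (\<lambda>i. Z i \<omega>) {0}) ?P ?V"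
    using indep_var_restrict[OF ind, of "{0}" "{1..m}"] by (simp add: initvec_def[abs_def])
  have joint: "P1 \<Otimes>\<^sub>M P2 = distr M (N \<Otimes>\<^sub>M ?P) (\<lambda>\<omega>. (Z 0 \<omega>, ?V \<omega>))"
  proof (rule pair_measure_eqI)
    show "sigma_finite_measure P1" "sigma_finite_measure P2" by unfold_locales
    show "sets (P1 \<Otimes>\<^sub>M P2) = sets (distr M (N \<Otimes>\<^sub>M ?P) (\<lambda>\<omega>. (Z 0 \<omega>, ?V \<omega>)))"
      unfolding sets_distr by (rule sets_pair_measure_cong) (simp_all add: P1_def P2_def)
    fix A C assume "A \<in> sets P1" "C \<in> sets P2"
    then have A[measurable]: "A \<in> sets N" and C[measurable]: "C \<in> sets ?P"
      by (simp_all add: P1_def P2_def)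
    let ?A = "(\<lambda>f. f 0) -` A \<inter> space (PiM {0} (\<lambda>_. N))"
    let ?X = "\<lambda>\<omega>. restrict (\<lambda>i. Z i \<omega>) {0::nat}"
    have "?A \<in> sets (PiM {0} (\<lambda>_. N))" by measurable
    from indep_varD[OF iv this C]
    have "prob ((\<lambda>\<omega>. (?X \<omega>, ?V \<omega>)) -` (?A \<times> C) \<inter> space M)
        = prob (?X -` ?A \<inter> space M) * prob (?V -` C \<inter> space M)" .
    moreover have "(\<lambda>\<omega>. (?X \<omega>, ?V \<omega>)) -` (?A \<times> C) \<inter> space M
        = (\<lambda>\<omega>. (Z 0 \<omega>, ?V \<omega>)) -` (A \<times> C) \<inter> space M"
      using measurable_space[OF Z] by (auto simp: space_PiM PiE_def)
    moreover have "?X -` ?A \<inter> space M = Z 0 -` A \<inter> space M"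
      using measurable_space[OF Z] by (auto simp: space_PiM PiE_def)
    moreover have "emeasure P1 A = prob (Z 0 -` A \<inter> space M)"
      by (simp add: P1_def emeasure_distr emeasure_eq_measure)
    moreover have "emeasure P2 C = prob (?V -` C \<inter> space M)"
      unfolding P2_def by (subst emeasure_distr[OF V C]) (rule emeasure_eq_measure)
    moreover have "emeasure (distr M (N \<Otimes>\<^sub>M ?P) (\<lambda>\<omega>. (Z 0 \<omega>, ?V \<omega>))) (A \<times> C)
        = prob ((\<lambda>\<omega>. (Z 0 \<omega>, ?V \<omega>)) -` (A \<times> C) \<inter> space M)"
      using measurable_Pair[OF Z[of 0] V] pair_measureI[OF A C]
      by (subst emeasure_distr) (auto simp: emeasure_eq_measure)
    ultimately show "emeasure P1 A * emeasure P2 C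
        = emeasure (distr M (N \<Otimes>\<^sub>M ?P) (\<lambda>\<omega>. (Z 0 \<omega>, ?V \<omega>))) (A \<times> C)"
      by (simp add: ennreal_mult)
  qed
  have geq: "?g w = (LINT z|P1. h z w)" if "w \<in> space ?P" for w
    unfolding P1_def
    by (rule integral_distr[symmetric]) (use that in measurable)
  have intP: "integrable (P1 \<Otimes>\<^sub>M P2) (\<lambda>(z, w). h z w)"
    unfolding joint by (subst integrable_distr_eq[OF measurable_Pair[OF Z[of 0] V] meas]) (use int in simp)
  have gint: "integrable M (\<lambda>\<omega>. ?g (?V \<omega>))"
  proof -
    have "integrable P2 (\<lambda>w. LINT z|P1. h z w)"
      using PP.integrable_snd[of "\<lambda>z w. h z w"] intP by simp
    then have "integrable P2 ?g"
      by (rule Bochner_Integration.integrable_cong[THEN iffD1, rotated -1])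
        (auto simp: geq P2_def)
    then show ?thesis unfolding P2_def by (subst (asm) integrable_distr_eq[OF V gm])
  qed
  have sub: "subalgebra M ?F"
    using sets_image_in_sets[OF _ V] by (auto simp: subalgebra_def)
  interpret fin_sub: finite_measure_subalgebra M ?F by standard (rule sub)
  have "AE \<omega> in M. real_cond_exp M ?F (\<lambda>\<omega>. h (Z 0 \<omega>) (?V \<omega>)) \<omega> = ?g (?V \<omega>)"
  proof (rule fin_sub.real_cond_exp_charact)
    fix A assume "A \<in> sets ?F"
    moreover have "?V \<in> space M \<rightarrow> space ?P"
      using measurable_space[OF V] by blast
    ultimately obtain C where C[measurable]: "C \<in> sets ?P" and A: "A = ?V -` C \<inter> space M"
      using sets_vimage_algebra2[of ?V "space M" ?P] by blast
    have intC: "integrable (P1 \<Otimes>\<^sub>M P2) (\<lambda>(z, w). indicator C w * h z w)"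
    proof (rule Bochner_Integration.integrable_bound[OF intP])
      have "(\<lambda>(z, w). indicator C w * h z w) \<in> borel_measurable (N \<Otimes>\<^sub>M ?P)"
        by measurable
      then show "(\<lambda>(z, w). indicator C w * h z w) \<in> borel_measurable (P1 \<Otimes>\<^sub>M P2)"
        unfolding joint by simp
    qed (auto simp: indicator_def)
    have mC: "(\<lambda>(z, w). indicator C w * h z w) \<in> borel_measurable (N \<Otimes>\<^sub>M ?P)"
      by measurable
    have "(LINT \<omega>:A|M. h (Z 0 \<omega>) (?V \<omega>)) = (LINT \<omega>|M. indicator C (?V \<omega>) * h (Z 0 \<omega>) (?V \<omega>))"
      unfolding set_lebesgue_integral_def A
      by (rule Bochner_Integration.integral_cong) (auto simp: indicator_def)
    also have "\<dots> = (LINT x|(P1 \<Otimes>\<^sub>M P2). (case x of (z, w) \<Rightarrow> indicator C w * h z w))"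
      unfolding joint by (subst integral_distr[OF measurable_Pair[OF Z[of 0] V] mC]) simp
    also have "\<dots> = (LINT w|P2. LINT z|P1. indicator C w * h z w)"
      using PP.integral_snd[of "\<lambda>z w. indicator C w * h z w"] intC by simp
    also have "\<dots> = (LINT w|P2. indicator C w * ?g w)"
      by (rule Bochner_Integration.integral_cong) (auto simp: geq P2_def)
    also have "\<dots> = (LINT \<omega>|M. indicator C (?V \<omega>) * ?g (?V \<omega>))"
      unfolding P2_def by (rule integral_distr[OF V]) measurable
    also have "\<dots> = (LINT \<omega>:A|M. ?g (?V \<omega>))"
      unfolding set_lebesgue_integral_def A
      by (rule Bochner_Integration.integral_cong) (auto simp: indicator_def)
    finally show "(LINT \<omega>:A|M. h (Z 0 \<omega>) (?V \<omega>)) = (LINT \<omega>:A|M. ?g (?V \<omega>))" .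
  next
    show "(\<lambda>\<omega>. ?g (?V \<omega>)) \<in> borel_measurable ?F"
      by (rule measurable_compose[OF measurable_vimage_algebra1 gm])
        (use measurable_space[OF V] in auto)
  qed (use int gint in auto)
  then show ?thesis
    unfolding is_cond_risk_def using gm by auto
qed

lemma is_cond_risk_cond_risk:
  fixes Z :: "nat \<Rightarrow> 'w \<Rightarrow> 'z" and h :: "'z \<Rightarrow> (nat \<Rightarrow> 'z) \<Rightarrow> real"
  assumes "prob_space M" "prob_space.indep_vars M (\<lambda>_. N) Z UNIV"
    "(\<lambda>(z, w). h z w) \<in> borel_measurable (N \<Otimes>\<^sub>M (\<Pi>\<^sub>M l\<in>{1..m}. N))"
    "integrable M (\<lambda>\<omega>. h (Z 0 \<omega>) (initvec Z m \<omega>))"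
  shows "is_cond_risk M N Z m h (cond_risk M N Z m h)"
  unfolding cond_risk_def by (rule someI[where P = "is_cond_risk M N Z m h"]) (rule is_cond_risk_integral[OF assms])

definition uniformly_integrable :: "'w measure \<Rightarrow> 'i set \<Rightarrow> ('i \<Rightarrow> 'w \<Rightarrow> real) \<Rightarrow> bool"
  where "uniformly_integrable M I X \<longleftrightarrow>
    (\<forall>i\<in>I. X i \<in> borel_measurable M) \<and>
    ((\<lambda>a. SUP i\<in>I. \<integral>\<^sup>+\<omega>. ennreal (\<bar>X i \<omega>\<bar> * indicator {a<..} \<bar>X i \<omega>\<bar>) \<partial>M) \<longlongrightarrow> 0) at_top"

definition tendsto_Lp ::
  "nat \<Rightarrow> 'w measure \<Rightarrow> ('i \<Rightarrow> 'w \<Rightarrow> real) \<Rightarrow> ('w \<Rightarrow> real) \<Rightarrow> 'i filter \<Rightarrow> bool"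
  where "tendsto_Lp p M X Y F \<longleftrightarrow>
    (\<forall>\<^sub>F n in F. X n \<in> borel_measurable M) \<and> Y \<in> borel_measurable M \<and>
    ((\<lambda>n. \<integral>\<^sup>+\<omega>. ennreal (\<bar>X n \<omega> - Y \<omega>\<bar> ^ p) \<partial>M) \<longlongrightarrow> 0) F"

text \<open>
  \<open>n \<rightarrow> \<infinity>\<close> along a set \<open>S\<close> of admissible sample sizes: for prime \<open>n\<close> there is no number of folds
  \<open>k\<close> with \<open>2 \<le> k < n\<close> dividing \<open>n\<close>, so \<open>S\<close> cannot be all (or almost all) of the naturals.
\<close>

abbreviation along :: "nat set \<Rightarrow> nat filter"
  where "along S \<equiv> inf sequentially (principal S)"

end

theory Submission
  imports Defs
begin

text \<open>
  Subtracting the conditional risk does not change the within-fold sample variances, so on each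
  fold the loss is, up to an irrelevant shift, \<open>\<sigma> (V\<^sub>i + D\<^sub>i)\<close>, where \<open>V\<^sub>i\<close> is the standardised mean
  loss at \<open>Z\<^sub>i\<close> and \<open>\<sigma> D\<^sub>i\<close> is the deviation of the centred loss from its mean over the training
  vector. The estimator is a nonnegative quadratic form \<open>Q\<close>, whence
  \<open>\<bar>Q(V + D) - Q(V)\<bar> \<le> \<eta> Q(V) + (1 + 1/\<eta>) Q(D)\<close> for every \<open>\<eta> > 0\<close>. The term \<open>Q(D)\<close> is at most twice
  the average of \<open>D\<^sub>i\<^sup>2\<close>, and the moments of \<open>D\<^sub>i\<close> of order 2 and 4 are controlled by the stabilities
  through an Efron--Stein inequality. Finally \<open>Q(V)\<close> is the average of \<open>V\<^sub>i\<^sup>2\<close>, which obeys a law of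
  large numbers, minus an off-diagonal term that is a martingale with second moment \<open>O(1/n)\<close>.
\<close>

section \<open>Moment forms of the Efron--Stein inequality\<close>

text \<open>Folds may contain only two points, so fold means need not concentrate and cannot be
  replaced by the population mean; every bound has to hold uniformly in the number of folds. The
  normalisation by \<open>n/k - 1\<close> rescues this: it gives the squares
  \<open>V\<^sub>i\<^sup>2\<close> the exact weight 1/n and leaves only products within a fold. The
  errors \<open>D\<close> of different folds share training points and have no usable independence.
  Since \<open>Q(D)\<close> is bounded by an average, only the joint law of one test point and a
  training vector not containing it matters, and that law is the same for all folds. Efron--Stein
  sums over the training coordinates while a stability averages over them. Hence a stability enters
  \<open>E D^2\<close> with a factor of order n and, because \<open>t = 1/m\<close> makes the
  constant of the fourth moment of order m, enters \<open>E D^4\<close> with n^2. These are the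
  rates of the two stability assumptions. The parameter \<open>\<eta>\<close> is made small only
  after n tends to infinity, so its negative powers are harmless. Both assertions are cases p = 1, 2
  of one estimate; they differ in the law of large numbers: truncation in \<open>L\<^sup>1\<close>,
  a variance bound in \<open>L\<^sup>2\<close>.\<close>

text \<open>In the induction over the coordinates, \<open>d\<close> is centred given \<open>c\<close>, so the term \<open>L c * d\<close> integrates
  to 0. The factor \<open>1 + t\<close> is iterated once per coordinate; \<open>t = 1/m\<close> keeps \<open>(1 + t) ^ m\<close> bounded.\<close>

definition moment_step :: "nat \<Rightarrow> real \<Rightarrow> real \<Rightarrow> bool"
  where "moment_step p t K \<longleftrightarrow> even p \<and> 0 < p \<and> 0 \<le> t \<and> 0 \<le> K \<and>
    (\<exists>L. \<forall>c d. (c + d) ^ p \<le> (1 + t) * c ^ p + L c * d + K * d ^ p)"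

text \<open>For the square, nothing beyond the linear term mixes \<open>c\<close> and
  \<open>d\<close>, so nothing has to be absorbed and \<open>t = 0\<close> is possible.\<close>

lemma moment_step_2: "moment_step 2 0 1"
  unfolding moment_step_def
  by (auto intro!: exI[of _ "\<lambda>c. 2 * c"] simp: power2_eq_square algebra_simps)

text \<open>Besides the linear term, \<open>c\<^sup>2 * d\<^sup>2\<close> and
  \<open>c * d ^ 3\<close> mix the two variables. The latter is traded for the former, and the
  resulting 6 + 2 = 8 copies are split between \<open>t * c ^ 4\<close> and
  \<open>16 / t * d ^ 4\<close>; a small \<open>t\<close> thus costs a \<open>K\<close> of order
  \<open>1 / t\<close>. The 3 collects the remaining 1 + 2 copies of \<open>d ^ 4\<close>.\<close>

lemma moment_step_4:
  fixes t :: real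
  assumes "t > 0"
  shows "moment_step 4 t (16 / t + 3)"
proof -
  have "(c + d) ^ 4 \<le> (1 + t) * c ^ 4 + 4 * c ^ 3 * d + (16 / t + 3) * d ^ 4" for c d :: real
  proof -
    have "0 \<le> 2 * (d\<^sup>2 - c * d)\<^sup>2" by simp
    then have 1: "4 * (c * d ^ 3) \<le> 2 * (c\<^sup>2 * d\<^sup>2) + 2 * d ^ 4"
      by (simp add: power2_eq_square eval_nat_numeral algebra_simps)
    have "0 \<le> (sqrt t * c\<^sup>2 - 4 / sqrt t * d\<^sup>2)\<^sup>2" by simp
    also have "\<dots> = t * c ^ 4 - 8 * (c\<^sup>2 * d\<^sup>2) + 16 / t * d ^ 4"
      using assms by (simp add: power2_diff power_mult_distrib power_divide real_sqrt_pow2 flip: power_mult)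
    finally have 2: "8 * (c\<^sup>2 * d\<^sup>2) \<le> t * c ^ 4 + 16 / t * d ^ 4" by simp
    have "(c + d) ^ 4 = c ^ 4 + 4 * c ^ 3 * d + 6 * (c\<^sup>2 * d\<^sup>2) + 4 * (c * d ^ 3) + d ^ 4"
      by (simp add: power2_eq_square eval_nat_numeral algebra_simps)
    with 1 2 show ?thesis by (simp add: algebra_simps)
  qed
  then show ?thesis
    unfolding moment_step_def using assms by (auto intro!: exI[of _ "\<lambda>c. 4 * c ^ 3"])
qed

lemma (in prob_space) power_expectation_le:
  fixes u :: "'a \<Rightarrow> real"
  assumes [measurable]: "u \<in> borel_measurable M" and bd: "\<And>x. x \<in> space M \<Longrightarrow> \<bar>u x\<bar> \<le> C" and p: "even p"
  shows "ennreal (expectation u ^ p) \<le> (\<integral>\<^sup>+x. ennreal (u x ^ p) \<partial>M)"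
proof -
  have i1: "integrable M u" by (rule integrable_const_bound[of _ C]) (use bd in auto)
  have i2: "integrable M (\<lambda>x. u x ^ p)"
    by (rule integrable_const_bound[of _ "C ^ p"]) (use bd in \<open>auto simp: power_abs intro!: power_mono\<close>)
  have "expectation u ^ p \<le> expectation (\<lambda>x. u x ^ p)"
    by (rule jensens_inequality[where I = UNIV]) (use i1 i2 convex_power_even[OF p] in auto)
  then show ?thesis
    by (subst nn_integral_eq_integral[OF i2]) (use p in \<open>auto intro!: ennreal_leI zero_le_even_power\<close>)
qed

text \<open>One coordinate of the induction, with \<open>c = expectation u - b\<close> and
  \<open>d = u x - expectation u\<close>. The shift \<open>b\<close> will be the mean over all
  coordinates, which differs from the mean of \<open>u\<close> while the other coordinates are held
  fixed. Jensen in a second copy turns the deviation from the mean into a resampling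
  difference.\<close>

lemma (in prob_space) moment_step_nn_integral:
  fixes u :: "'a \<Rightarrow> real"
  assumes [measurable]: "u \<in> borel_measurable M" and bd: "\<And>x. x \<in> space M \<Longrightarrow> \<bar>u x\<bar> \<le> C"
    and st: "moment_step p t K"
  shows "(\<integral>\<^sup>+x. ennreal ((u x - b) ^ p) \<partial>M)
    \<le> ennreal (1 + t) * ennreal ((expectation u - b) ^ p)
      + ennreal K * (\<integral>\<^sup>+x. \<integral>\<^sup>+y. ennreal ((u x - u y) ^ p) \<partial>M \<partial>M)"
proof -
  define e where "e = expectation u"
  from st obtain L where p: "even p" and t: "0 \<le> t" "0 \<le> K"
    and L: "\<And>c d. (c + d) ^ p \<le> (1 + t) * c ^ p + L c * d + K * d ^ p"
    unfolding moment_step_def by blast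
  have i1[simp]: "integrable M u" by (rule integrable_const_bound[of _ C]) (use bd in auto)
  have i3[simp]: "integrable M (\<lambda>x. (u x - c) ^ p)" for c
    by (rule integrable_const_bound[of _ "(C + \<bar>c\<bar>) ^ p"])
      (use bd in \<open>force simp: power_abs intro!: power_mono\<close>)+
  have nn: "0 \<le> (r::real) ^ p" for r using p by (simp add: zero_le_even_power)
  have "expectation (\<lambda>x. (u x - b) ^ p)
      \<le> expectation (\<lambda>x. (1 + t) * (e - b) ^ p + L (e - b) * (u x - e) + K * (u x - e) ^ p)"
    using L[of "e - b" "u x - e" for x] by (intro integral_mono) auto
  also have "\<dots> = (1 + t) * (e - b) ^ p + K * expectation (\<lambda>x. (u x - e) ^ p)"
    by (simp add: prob_space e_def)
  finally have "ennreal (expectation (\<lambda>x. (u x - b) ^ p))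
      \<le> ennreal ((1 + t) * (e - b) ^ p + K * expectation (\<lambda>x. (u x - e) ^ p))"
    by (rule ennreal_leI)
  also have "\<dots> = ennreal (1 + t) * ennreal ((e - b) ^ p)
      + ennreal K * ennreal (expectation (\<lambda>x. (u x - e) ^ p))"
    using t nn by (simp add: ennreal_mult ennreal_plus integral_nonneg)
  also have "ennreal (expectation (\<lambda>x. (u x - e) ^ p)) = (\<integral>\<^sup>+x. ennreal ((u x - e) ^ p) \<partial>M)"
    by (subst nn_integral_eq_integral) (use nn in auto)
  also have "\<dots> \<le> (\<integral>\<^sup>+x. \<integral>\<^sup>+y. ennreal ((u x - u y) ^ p) \<partial>M \<partial>M)"
  proof (rule nn_integral_mono)
    fix x assume x: "x \<in> space M"
    have "u x - e = expectation (\<lambda>y. u x - u y)"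
      by (simp add: e_def prob_space)
    also have "ennreal (\<dots> ^ p) \<le> (\<integral>\<^sup>+y. ennreal ((u x - u y) ^ p) \<partial>M)"
      by (rule power_expectation_le[where C = "C + C"]) (use bd[OF x] bd p in \<open>force+\<close>)
    finally show "ennreal ((u x - e) ^ p) \<le> (\<integral>\<^sup>+y. ennreal ((u x - u y) ^ p) \<partial>M)" .
  qed
  finally show ?thesis
    by (subst nn_integral_eq_integral) (use nn in \<open>auto simp: e_def mult_left_mono add_left_mono\<close>)
qed

text \<open>Averaging out the new coordinate \<open>a\<close> gives \<open>g\<close>. Then
  \<open>f - e\<close> splits into \<open>g - e\<close>, covered by the induction hypothesis, and
  the deviation of \<open>f\<close> from \<open>g\<close>, covered by the one-coordinate step.
  Boundedness makes every integral on the way finite; the next lemma removes it.\<close>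

lemma (in prob_space) efron_stein_moment_bounded:
  fixes f :: "('i \<Rightarrow> 'a) \<Rightarrow> real"
  assumes st: "moment_step p t K" and I: "finite I"
    and f: "f \<in> borel_measurable (\<Pi>\<^sub>M i\<in>I. M)"
    and bd: "\<And>x. x \<in> space (\<Pi>\<^sub>M i\<in>I. M) \<Longrightarrow> \<bar>f x\<bar> \<le> C"
  shows "(\<integral>\<^sup>+x. ennreal ((f x - (LINT x|(\<Pi>\<^sub>M i\<in>I. M). f x)) ^ p) \<partial>(\<Pi>\<^sub>M i\<in>I. M))
    \<le> ennreal ((1 + t) ^ card I * K) *
      (\<Sum>i\<in>I. \<integral>\<^sup>+x. \<integral>\<^sup>+y. ennreal ((f x - f (x(i := y))) ^ p) \<partial>M \<partial>(\<Pi>\<^sub>M i\<in>I. M))"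
  using I f bd
proof (induction I arbitrary: f rule: finite_induct)
  case empty
  \<comment> \<open>Over no coordinates \<open>f\<close> equals its mean, and \<open>0 < p\<close>
    makes the power vanish.\<close>
  have "0 < p" using st by (auto simp: moment_step_def)
  then show ?case
    by (simp add: PiM_empty nn_integral_count_space_finite lebesgue_integral_count_space_finite)
next
  case (insert a I)
  interpret P: product_prob_space "\<lambda>_::'i. M" I
    by standard
  let ?PI = "\<Pi>\<^sub>M i\<in>I. M" and ?PJ = "\<Pi>\<^sub>M i\<in>insert a I. M"
  from st have p: "even p" and t: "0 \<le> t" "0 \<le> K"
    unfolding moment_step_def by blast+
  have nn: "0 \<le> (r::real) ^ p" for r using p by (simp add: zero_le_even_power)
  note f[measurable] = insert.prems(1)
  have upd[measurable]: "(\<lambda>x. (v x)(a := w x)) \<in> L \<rightarrow>\<^sub>M ?PJ"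
    if "v \<in> L \<rightarrow>\<^sub>M ?PI" "w \<in> L \<rightarrow>\<^sub>M M" for v w and L :: "'x measure"
    by (rule measurable_fun_upd[where J = I]) (use that in auto)
  have updI[measurable]: "(\<lambda>x. (v x)(i := w x)) \<in> L \<rightarrow>\<^sub>M ?PI"
    if "v \<in> L \<rightarrow>\<^sub>M ?PI" "w \<in> L \<rightarrow>\<^sub>M M" "i \<in> I" for i v w and L :: "'x measure"
    by (rule measurable_fun_upd[where J = I]) (use that in auto)
  have updJ[measurable]: "(\<lambda>x. (v x)(i := w x)) \<in> L \<rightarrow>\<^sub>M ?PJ"
    if "v \<in> L \<rightarrow>\<^sub>M ?PJ" "w \<in> L \<rightarrow>\<^sub>M M" "i \<in> insert a I" for i v w and L :: "'x measure"
    by (rule measurable_fun_upd[where J = "insert a I"]) (use that in auto)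
  have spJ: "x(a := y) \<in> space ?PJ" if "x \<in> space ?PI" "y \<in> space M" for x y
    using that by (auto simp: space_PiM PiE_def extensional_def)
  have fbd: "\<bar>f (x(a := y))\<bar> \<le> C" if "x \<in> space ?PI" "y \<in> space M" for x y
    using insert.prems(2)[OF spJ[OF that]] .
  have fint: "integrable M (\<lambda>y. f (x(a := y)))" if x: "x \<in> space ?PI" for x
  proof (rule integrable_const_bound[of _ C])
    show "AE y in M. norm (f (x(a := y))) \<le> C"
      by (rule AE_I2) (use fbd[OF x] in simp)
  qed (use x in simp)
  define g where "g = (\<lambda>x. LINT y|M. f (x(a := y)))"
  have gm[measurable]: "g \<in> borel_measurable ?PI"
    unfolding g_def by measurable
  have gb: "\<bar>g x\<bar> \<le> C" if "x \<in> space ?PI" for x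
  proof -
    have "norm (g x) \<le> (LINT y|M. C)"
      unfolding g_def
      by (rule order_trans[OF integral_norm_bound integral_mono])
        (use fbd[OF that] fint[OF that] in simp_all)
    then show ?thesis by (simp add: prob_space)
  qed
  interpret PJ: prob_space ?PJ by (rule prob_space_PiM) (rule prob_space_axioms)
  have intf: "integrable ?PJ f"
    by (rule PJ.integrable_const_bound[of _ C]) (use insert.prems(2) in auto)
  have mean: "(LINT x|?PJ. f x) = (LINT x|?PI. g x)"
    unfolding g_def using P.product_integral_insert[OF insert.hyps intf] .
  define e where "e = (LINT x|?PI. g x)"
  \<comment> \<open>The value of \<open>a\<close> before resampling is one more coordinate of the
    product over \<open>insert a I\<close>, so this iterated integral is the influence of
    \<open>a\<close> on \<open>f\<close>.\<close>
  have T1: "(\<integral>\<^sup>+x. \<integral>\<^sup>+y. \<integral>\<^sup>+y'. ennreal ((f (x(a := y)) - f (x(a := y'))) ^ p) \<partial>M \<partial>M \<partial>?PI)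
      = (\<integral>\<^sup>+x. \<integral>\<^sup>+y. ennreal ((f x - f (x(a := y))) ^ p) \<partial>M \<partial>?PJ)"
    by (subst P.product_nn_integral_insert[OF insert.hyps]) simp_all
  \<comment> \<open>Averaging over \<open>a\<close> cannot increase the influence of another
    coordinate: Jensen moves the power inside the average, and Fubini exchanges \<open>a\<close>
    with the resampled value of \<open>i\<close>.\<close>
  have T2: "(\<integral>\<^sup>+x. \<integral>\<^sup>+y. ennreal ((g x - g (x(i := y))) ^ p) \<partial>M \<partial>?PI)
      \<le> (\<integral>\<^sup>+x. \<integral>\<^sup>+y. ennreal ((f x - f (x(i := y))) ^ p) \<partial>M \<partial>?PJ)" if i: "i \<in> I" for i
  proof -
    have ia: "i \<noteq> a" using i insert.hyps by auto
    have "(\<integral>\<^sup>+x. \<integral>\<^sup>+y. ennreal ((g x - g (x(i := y))) ^ p) \<partial>M \<partial>?PI)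
      \<le> (\<integral>\<^sup>+x. \<integral>\<^sup>+y. \<integral>\<^sup>+y'. ennreal ((f (x(a := y')) - f (x(i := y, a := y'))) ^ p) \<partial>M \<partial>M \<partial>?PI)"
    proof (intro nn_integral_mono)
      fix x y assume x: "x \<in> space ?PI" and y: "y \<in> space M"
      have x': "x(i := y) \<in> space ?PI" using x y i by (auto simp: space_PiM PiE_def extensional_def)
      have "g x - g (x(i := y)) = (LINT y'|M. f (x(a := y')) - f (x(i := y, a := y')))"
        unfolding g_def using fint[OF x] fint[OF x'] by simp
      also have "ennreal (\<dots> ^ p) \<le> (\<integral>\<^sup>+y'. ennreal ((f (x(a := y')) - f (x(i := y, a := y'))) ^ p) \<partial>M)"
      proof (rule power_expectation_le[where C = "C + C"])
        show "(\<lambda>y'. f (x(a := y')) - f (x(i := y, a := y'))) \<in> borel_measurable M"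
          using x x' by simp
        fix y' assume "y' \<in> space M"
        then show "\<bar>f (x(a := y')) - f (x(i := y, a := y'))\<bar> \<le> C + C"
          using fbd[OF x] fbd[OF x'] by (smt (verit))
      qed (rule p)
      finally show "ennreal ((g x - g (x(i := y))) ^ p)
        \<le> (\<integral>\<^sup>+y'. ennreal ((f (x(a := y')) - f (x(i := y, a := y'))) ^ p) \<partial>M)" .
    qed
    also have "\<dots> = (\<integral>\<^sup>+x. \<integral>\<^sup>+y'. \<integral>\<^sup>+y. ennreal ((f (x(a := y')) - f (x(a := y', i := y))) ^ p) \<partial>M \<partial>M \<partial>?PI)"
    proof (rule nn_integral_cong)
      fix x assume x: "x \<in> space ?PI"
      interpret MM: pair_sigma_finite M M ..
      have "(\<lambda>(y, y'). ennreal ((f (x(a := y')) - f (x(i := y, a := y'))) ^ p)) \<in> borel_measurable (M \<Otimes>\<^sub>M M)"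
        using x i by measurable
      from MM.Fubini'[OF this] ia
      show "(\<integral>\<^sup>+y. \<integral>\<^sup>+y'. ennreal ((f (x(a := y')) - f (x(i := y, a := y'))) ^ p) \<partial>M \<partial>M)
        = (\<integral>\<^sup>+y'. \<integral>\<^sup>+y. ennreal ((f (x(a := y')) - f (x(a := y', i := y))) ^ p) \<partial>M \<partial>M)"
        by (simp add: fun_upd_twist)
    qed
    also have "\<dots> = (\<integral>\<^sup>+x. \<integral>\<^sup>+y. ennreal ((f x - f (x(i := y))) ^ p) \<partial>M \<partial>?PJ)"
      by (subst P.product_nn_integral_insert[OF insert.hyps]) (use i in simp_all)
    finally show ?thesis .
  qed
  have "(\<integral>\<^sup>+x. ennreal ((f x - (LINT x|?PJ. f x)) ^ p) \<partial>?PJ)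
      = (\<integral>\<^sup>+x. \<integral>\<^sup>+y. ennreal ((f (x(a := y)) - e) ^ p) \<partial>M \<partial>?PI)"
    unfolding mean e_def by (subst P.product_nn_integral_insert[OF insert.hyps]) simp_all
  also have "\<dots> \<le> (\<integral>\<^sup>+x. (ennreal (1 + t) * ennreal ((g x - e) ^ p)
      + ennreal K * (\<integral>\<^sup>+y. \<integral>\<^sup>+y'. ennreal ((f (x(a := y)) - f (x(a := y'))) ^ p) \<partial>M \<partial>M)) \<partial>?PI)"
    unfolding g_def
    by (intro nn_integral_mono moment_step_nn_integral[where C = C] st)
      (use fbd in simp_all)
  also have "\<dots> = ennreal (1 + t) * (\<integral>\<^sup>+x. ennreal ((g x - e) ^ p) \<partial>?PI)
      + ennreal K * (\<integral>\<^sup>+x. \<integral>\<^sup>+y. ennreal ((f x - f (x(a := y))) ^ p) \<partial>M \<partial>?PJ)"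
    unfolding T1[symmetric] by (subst nn_integral_add) (simp_all add: nn_integral_cmult)
  also have "(\<integral>\<^sup>+x. ennreal ((g x - e) ^ p) \<partial>?PI)
    \<le> ennreal ((1 + t) ^ card I * K) * (\<Sum>i\<in>I. \<integral>\<^sup>+x. \<integral>\<^sup>+y. ennreal ((g x - g (x(i := y))) ^ p) \<partial>M \<partial>?PI)"
    unfolding e_def by (rule insert.IH) (use gm gb in auto)
  also have "\<dots> \<le> ennreal ((1 + t) ^ card I * K) *
      (\<Sum>i\<in>I. \<integral>\<^sup>+x. \<integral>\<^sup>+y. ennreal ((f x - f (x(i := y))) ^ p) \<partial>M \<partial>?PJ)"
    by (intro mult_left_mono sum_mono T2) auto
  also have "ennreal (1 + t) * \<dots> = ennreal ((1 + t) ^ card (insert a I) * K) *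
      (\<Sum>i\<in>I. \<integral>\<^sup>+x. \<integral>\<^sup>+y. ennreal ((f x - f (x(i := y))) ^ p) \<partial>M \<partial>?PJ)"
    using insert.hyps t by (simp add: ennreal_mult mult.assoc)
  \<comment> \<open>The new coordinate carries only the factor \<open>K\<close>; it is enlarged so
    that all coordinates share one factor.\<close>
  also have "ennreal K \<le> ennreal ((1 + t) ^ card (insert a I) * K)"
    using t by (intro ennreal_leI mult_le_cancel_right1[THEN iffD2]) (auto intro: one_le_power)
  finally show ?case
    using insert.hyps by (simp add: distrib_left add.commute add_mono mult_left_mono mult_right_mono)
qed

text \<open>Clamping to \<open>[-n, n]\<close> is 1-Lipschitz, so the clamped functions have smaller
  influences and obey the bound with the right-hand side of \<open>f\<close> itself. The means
  converge by dominated convergence, and Fatou handles the left-hand side.\<close>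

lemma (in prob_space) efron_stein_moment:
  fixes f :: "('i \<Rightarrow> 'a) \<Rightarrow> real"
  assumes st: "moment_step p t K" and I: "finite I"
    and int: "integrable (\<Pi>\<^sub>M i\<in>I. M) f"
  shows "(\<integral>\<^sup>+x. ennreal ((f x - (LINT x|(\<Pi>\<^sub>M i\<in>I. M). f x)) ^ p) \<partial>(\<Pi>\<^sub>M i\<in>I. M))
    \<le> ennreal ((1 + t) ^ card I * K) *
      (\<Sum>i\<in>I. \<integral>\<^sup>+x. \<integral>\<^sup>+y. ennreal ((f x - f (x(i := y))) ^ p) \<partial>M \<partial>(\<Pi>\<^sub>M i\<in>I. M))"
    (is "_ \<le> ?B")
proof -
  let ?PI = "\<Pi>\<^sub>M i\<in>I. M"
  have p: "even p" using st by (auto simp: moment_step_def)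
  interpret PI: prob_space ?PI by (rule prob_space_PiM) (rule prob_space_axioms)
  have f[measurable]: "f \<in> borel_measurable ?PI" using int by auto
  define F where "F = (\<lambda>n x. max (- real n) (min (real n) (f x)))"
  have F[measurable]: "F n \<in> borel_measurable ?PI" for n
    unfolding F_def by measurable
  have Flim: "(\<lambda>n. F n x) \<longlonglongrightarrow> f x" for x
  proof (rule tendsto_eventually)
    obtain k where k: "\<bar>f x\<bar> \<le> real k" using real_arch_simple by blast
    show "\<forall>\<^sub>F n in sequentially. F n x = f x"
      using eventually_ge_at_top[of k] by eventually_elim (use k in \<open>auto simp: F_def\<close>)
  qed
  have mlim: "(\<lambda>n. LINT x|?PI. F n x) \<longlonglongrightarrow> (LINT x|?PI. f x)"
    by (rule integral_dominated_convergence[where w = "\<lambda>x. \<bar>f x\<bar>"])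
      (use int Flim in \<open>auto simp: F_def\<close>)
  have "(\<lambda>n. ennreal ((F n x - (LINT x|?PI. F n x)) ^ p))
      \<longlonglongrightarrow> ennreal ((f x - (LINT x|?PI. f x)) ^ p)" for x
    by (intro tendsto_ennrealI tendsto_power tendsto_diff Flim mlim)
  then have "(\<integral>\<^sup>+x. ennreal ((f x - (LINT x|?PI. f x)) ^ p) \<partial>?PI)
      = (\<integral>\<^sup>+x. liminf (\<lambda>n. ennreal ((F n x - (LINT x|?PI. F n x)) ^ p)) \<partial>?PI)"
    by (intro nn_integral_cong sym[OF lim_imp_Liminf]) simp_all
  also have "\<dots> \<le> liminf (\<lambda>n. \<integral>\<^sup>+x. ennreal ((F n x - (LINT x|?PI. F n x)) ^ p) \<partial>?PI)"
    by (rule nn_integral_liminf) measurable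
  also have "\<dots> \<le> limsup (\<lambda>n. \<integral>\<^sup>+x. ennreal ((F n x - (LINT x|?PI. F n x)) ^ p) \<partial>?PI)"
    by (rule Liminf_le_Limsup) simp
  also have "\<dots> \<le> ?B"
  proof (intro Limsup_bounded always_eventually allI)
    fix n
    have "(\<integral>\<^sup>+x. ennreal ((F n x - (LINT x|?PI. F n x)) ^ p) \<partial>?PI)
      \<le> ennreal ((1 + t) ^ card I * K) *
        (\<Sum>i\<in>I. \<integral>\<^sup>+x. \<integral>\<^sup>+y. ennreal ((F n x - F n (x(i := y))) ^ p) \<partial>M \<partial>?PI)"
      by (rule efron_stein_moment_bounded[OF st I F, where C = "real n"]) (auto simp: F_def)
    also have "\<dots> \<le> ?B"
    proof (intro mult_left_mono sum_mono nn_integral_mono ennreal_leI)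
      fix i x y
      have "\<bar>F n x - F n (x(i := y))\<bar> \<le> \<bar>f x - f (x(i := y))\<bar>"
        unfolding F_def by (auto simp: max_def min_def)
      then have "\<bar>F n x - F n (x(i := y))\<bar> ^ p \<le> \<bar>f x - f (x(i := y))\<bar> ^ p"
        by (intro power_mono) auto
      then show "(F n x - F n (x(i := y))) ^ p \<le> (f x - f (x(i := y))) ^ p"
        using p by (simp add: power_even_abs)
    qed auto
    finally show "(\<integral>\<^sup>+x. ennreal ((F n x - (LINT x|?PI. F n x)) ^ p) \<partial>?PI) \<le> ?B" .
  qed
  finally show ?thesis .
qed

text \<open>The constant is \<open>57 = 3 * 19\<close>: with \<open>t = 1 / m\<close> the growth
  factor is at most \<open>exp 1 \<le> 3\<close>, and \<open>K = 16 * m + 3 \<le> 19 * m\<close>.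
  The factor of order \<open>m\<close> in \<open>K\<close> is the \<open>m ^ (q - 1)\<close> of the
  fourth moment; for the square the constant is merely generous.\<close>

lemma (in prob_space) efron_stein_2_4:
  fixes f :: "('i \<Rightarrow> 'a) \<Rightarrow> real"
  assumes q: "q = 1 \<or> q = 2" and I: "finite I" "I \<noteq> {}"
    and int: "integrable (\<Pi>\<^sub>M i\<in>I. M) f"
  shows "(\<integral>\<^sup>+x. ennreal ((f x - (LINT x|(\<Pi>\<^sub>M i\<in>I. M). f x)) ^ (2 * q)) \<partial>(\<Pi>\<^sub>M i\<in>I. M))
    \<le> ennreal (57 * real (card I) ^ (q - 1)) *
      (\<Sum>i\<in>I. \<integral>\<^sup>+x. \<integral>\<^sup>+y. ennreal ((f x - f (x(i := y))) ^ (2 * q)) \<partial>M \<partial>(\<Pi>\<^sub>M i\<in>I. M))"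
proof -
  define m where "m = real (card I)"
  have m: "m \<ge> 1" using I by (simp add: m_def Suc_le_eq card_gt_0_iff)
  have "\<exists>t K. moment_step (2 * q) t K \<and> (1 + t) ^ card I * K \<le> 57 * m ^ (q - 1)"
    using q
  proof
    assume "q = 1"
    then show ?thesis using moment_step_2 by (intro exI[of _ 0] exI[of _ 1]) auto
  next
    assume q2: "q = 2"
    have "(1 + 1 / m) ^ card I \<le> exp (1 / m) ^ card I"
      using m by (intro power_mono) auto
    also have "\<dots> = exp 1"
      using m by (simp add: m_def flip: exp_of_nat_mult)
    also have "\<dots> \<le> 3" by (rule exp_le)
    finally have "(1 + 1 / m) ^ card I * (16 / (1 / m) + 3) \<le> 3 * (19 * m)"
      using m by (intro mult_mono) auto
    with q2 m moment_step_4[of "1 / m"] show ?thesis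
      by (intro exI[of _ "1 / m"] exI[of _ "16 / (1 / m) + 3"]) auto
  qed
  then obtain t K where st: "moment_step (2 * q) t K" and le: "(1 + t) ^ card I * K \<le> 57 * m ^ (q - 1)"
    by blast
  show ?thesis
    by (rule order_trans[OF efron_stein_moment[OF st I(1) int]])
      (use le in \<open>auto simp: m_def intro!: mult_right_mono ennreal_leI\<close>)
qed

section \<open>I.i.d. samples\<close>

locale iid_sample = prob_space M for M :: "'w measure" +
  fixes N :: "'z measure" and Z :: "nat \<Rightarrow> 'w \<Rightarrow> 'z"
  assumes indep: "indep_vars (\<lambda>_. N) Z UNIV"
    and ident: "\<And>i. distr M N (Z i) = distr M N (Z 0)"
begin

definition P :: "'z measure" where "P = distr M N (Z 0)"

lemma sets_P[simp, measurable_cong]: "sets P = sets N"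
  by (simp add: P_def)

lemma space_P[simp]: "space P = space N"
  by (simp add: P_def)

lemma Z_measurable[measurable]: "Z i \<in> measurable M N"
  using indep by (auto simp: indep_vars_def)

lemma prob_space_P: "prob_space P"
  unfolding P_def by (rule prob_space_distr) simp

section \<open>Transfer of expectations over the sample to product measures\<close>

lemma nn_integral_Z: "f \<in> borel_measurable N \<Longrightarrow> (\<integral>\<^sup>+\<omega>. f (Z i \<omega>) \<partial>M) = (\<integral>\<^sup>+z. f z \<partial>P)"
  unfolding P_def ident[of i, symmetric] by (simp add: nn_integral_distr)

lemma integral_Z: "f \<in> borel_measurable N \<Longrightarrow> (LINT \<omega>|M. f (Z i \<omega>)) = (LINT z|P. f z :: real)"
  unfolding P_def ident[of i, symmetric] by (simp add: integral_distr)

lemma integrable_Z: "f \<in> borel_measurable N \<Longrightarrow> integrable M (\<lambda>\<omega>. f (Z i \<omega>)) \<longleftrightarrow> integrable P (f :: 'z \<Rightarrow> real)"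
  unfolding P_def ident[of i, symmetric] by (simp add: integrable_distr_eq)

text \<open>Injectivity makes the blocks \<open>{\<tau> l}\<close> disjoint, so the selected
  observations are independent with common law \<open>P\<close>. As the result does not depend on
  \<open>\<tau>\<close>, every fold can be compared with \<open>Z 0\<close> and
  \<open>initvec Z m\<close>.\<close>

lemma distr_reindex:
  assumes L: "finite L" "L \<noteq> {}" and \<tau>: "inj_on \<tau> L"
  shows "distr M (\<Pi>\<^sub>M l\<in>L. N) (\<lambda>\<omega>. \<lambda>l\<in>L. Z (\<tau> l) \<omega>) = (\<Pi>\<^sub>M l\<in>L. P)"
proof -
  have "indep_vars (\<lambda>l. PiM {\<tau> l} (\<lambda>_. N)) (\<lambda>l \<omega>. restrict (\<lambda>i. Z i \<omega>) {\<tau> l}) L"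
    by (rule indep_vars_restrict[OF indep]) (use \<tau> in \<open>auto simp: disjoint_family_on_def inj_on_def\<close>)
  then have "indep_vars (\<lambda>_. N) (\<lambda>l \<omega>. (\<lambda>f. f (\<tau> l)) (restrict (\<lambda>i. Z i \<omega>) {\<tau> l})) L"
    by (rule indep_vars_compose2) auto
  then have "indep_vars (\<lambda>_. N) (\<lambda>l. Z (\<tau> l)) L" by simp
  then have "distr M (\<Pi>\<^sub>M l\<in>L. N) (\<lambda>\<omega>. \<lambda>l\<in>L. Z (\<tau> l) \<omega>) = (\<Pi>\<^sub>M l\<in>L. distr M N (Z (\<tau> l)))"
    using indep_vars_iff_distr_eq_PiM'[OF L(2), where M' = "\<lambda>_. N" and X = "\<lambda>l. Z (\<tau> l)"] by simp
  also have "\<dots> = (\<Pi>\<^sub>M l\<in>L. P)"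
    unfolding P_def by (rule PiM_cong) (auto intro: ident)
  finally show ?thesis .
qed

lemma initvec_measurable[measurable]: "initvec Z m \<in> measurable M (\<Pi>\<^sub>M l\<in>{1..m}. N)"
  unfolding initvec_def[abs_def] by (intro measurable_restrict Z_measurable)

lemma distr_initvec:
  assumes "1 \<le> m"
  shows "distr M (\<Pi>\<^sub>M l\<in>{1..m}. N) (initvec Z m) = (\<Pi>\<^sub>M l\<in>{1..m}. P)"
  using distr_reindex[of "{1..m}" "\<lambda>l. l"] assms by (simp add: initvec_def[abs_def])

lemma sets_PiM_P: "sets (\<Pi>\<^sub>M l\<in>L. P) = sets (\<Pi>\<^sub>M l\<in>L. N)"
  by (rule sets_PiM_cong) auto

lemma product_prob_space_P: "product_prob_space (\<lambda>_. P)"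
proof -
  interpret P: prob_space P by (rule prob_space_P)
  show ?thesis by standard
qed

text \<open>Coordinate 0 holds the test point, so test point and training vector can be handled as
  one vector and separated by Fubini afterwards.\<close>

lemma nn_integral_split_test_point:
  fixes G :: "'z \<Rightarrow> (nat \<Rightarrow> 'z) \<Rightarrow> ennreal"
  assumes G: "(\<lambda>(z, w). G z w) \<in> borel_measurable (N \<Otimes>\<^sub>M (\<Pi>\<^sub>M l\<in>{1..m}. N))"
  shows "(\<integral>\<^sup>+x. G (x 0) (restrict x {1..m}) \<partial>(\<Pi>\<^sub>M l\<in>{0..m}. P)) = (\<integral>\<^sup>+z. \<integral>\<^sup>+w. G z w \<partial>(\<Pi>\<^sub>M l\<in>{1..m}. P) \<partial>P)"
proof -
  interpret PP: product_prob_space "\<lambda>_::nat. P" "{1..m}" by (rule product_prob_space_P)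
  have L: "{0..m} = insert 0 {1..m}" by auto
  have meas: "(\<lambda>x. G (x 0) (restrict x {1..m})) \<in> borel_measurable (\<Pi>\<^sub>M l\<in>{0..m}. P)"
  proof -
    have "(\<lambda>x. (x 0, restrict x {1..m})) \<in> (\<Pi>\<^sub>M l\<in>{0..m}. P) \<rightarrow>\<^sub>M N \<Otimes>\<^sub>M (\<Pi>\<^sub>M l\<in>{1..m}. N)"
      by (intro measurable_Pair measurable_restrict) auto
    from measurable_compose[OF this G] show ?thesis by simp
  qed
  have "restrict (w(0 := z)) {1..m} = w" if "w \<in> space (\<Pi>\<^sub>M l\<in>{1..m}. P)" for w :: "nat \<Rightarrow> 'z" and z
    using that by (auto simp: space_PiM PiE_def extensional_def restrict_def fun_eq_iff)
  then have "(\<integral>\<^sup>+z. \<integral>\<^sup>+w. G ((w(0 := z)) 0) (restrict (w(0 := z)) {1..m}) \<partial>(\<Pi>\<^sub>M l\<in>{1..m}. P) \<partial>P)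
      = (\<integral>\<^sup>+z. \<integral>\<^sup>+w. G z w \<partial>(\<Pi>\<^sub>M l\<in>{1..m}. P) \<partial>P)"
    by (intro nn_integral_cong) (simp only: fun_upd_same)
  moreover have "finite {1..m}" "0 \<notin> {1..m}" by simp_all
  from PP.product_nn_integral_insert_rev[OF this meas[unfolded L]]
  have "(\<integral>\<^sup>+x. G (x 0) (restrict x {1..m}) \<partial>(\<Pi>\<^sub>M l\<in>{0..m}. P))
      = (\<integral>\<^sup>+z. \<integral>\<^sup>+w. G ((w(0 := z)) 0) (restrict (w(0 := z)) {1..m}) \<partial>(\<Pi>\<^sub>M l\<in>{1..m}. P) \<partial>P)"
    unfolding L .
  ultimately show ?thesis by simp
qed

text \<open>Since \<open>i\<close> does not occur in \<open>b\<close>, the list \<open>i # b\<close>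
  selects distinct observations; hence a test point outside its training vector has the same joint
  law with it in every fold.\<close>

lemma nn_integral_subvec:
  fixes G :: "'z \<Rightarrow> (nat \<Rightarrow> 'z) \<Rightarrow> ennreal"
  assumes b: "distinct b" "length b = m" "i \<notin> set b"
    and G: "(\<lambda>(z, w). G z w) \<in> borel_measurable (N \<Otimes>\<^sub>M (\<Pi>\<^sub>M l\<in>{1..m}. N))"
  shows "(\<integral>\<^sup>+\<omega>. G (Z i \<omega>) (subvec Z b \<omega>) \<partial>M) = (\<integral>\<^sup>+z. \<integral>\<^sup>+w. G z w \<partial>(\<Pi>\<^sub>M l\<in>{1..m}. P) \<partial>P)"
proof -
  \<comment> \<open>Position 0 is the test index, and position \<open>l\<close> of
    \<open>i # b\<close> is \<open>b ! (l - 1)\<close>, the shift built into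
    \<open>subvec\<close>.\<close>
  define \<tau> where "\<tau> l = (i # b) ! l" for l
  have inj: "inj_on \<tau> {0..m}"
    unfolding \<tau>_def using b by (intro inj_on_nth) auto
  define V where "V \<omega> = (\<lambda>l\<in>{0..m}. Z (\<tau> l) \<omega>)" for \<omega>
  have V[measurable]: "V \<in> M \<rightarrow>\<^sub>M (\<Pi>\<^sub>M l\<in>{0..m}. N)"
    unfolding V_def[abs_def] by (intro measurable_restrict Z_measurable)
  have "G (Z i \<omega>) (subvec Z b \<omega>) = G (V \<omega> 0) (restrict (V \<omega>) {1..m})" for \<omega>
  proof -
    have "subvec Z b \<omega> = restrict (V \<omega>) {1..m}"
      unfolding subvec_def V_def b(2) by (auto simp: fun_eq_iff \<tau>_def nth_Cons')
    then show ?thesis by (simp add: V_def \<tau>_def)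
  qed
  then have "(\<integral>\<^sup>+\<omega>. G (Z i \<omega>) (subvec Z b \<omega>) \<partial>M) = (\<integral>\<^sup>+\<omega>. G (V \<omega> 0) (restrict (V \<omega>) {1..m}) \<partial>M)"
    by simp
  also have "\<dots> = (\<integral>\<^sup>+x. G (x 0) (restrict x {1..m}) \<partial>distr M (\<Pi>\<^sub>M l\<in>{0..m}. N) V)"
  proof (rule nn_integral_distr[symmetric, OF V])
    have "(\<lambda>x. (x 0, restrict x {1..m})) \<in> (\<Pi>\<^sub>M l\<in>{0..m}. N) \<rightarrow>\<^sub>M N \<Otimes>\<^sub>M (\<Pi>\<^sub>M l\<in>{1..m}. N)"
      by (intro measurable_Pair measurable_restrict) auto
    from measurable_compose[OF this G]
    show "(\<lambda>x. G (x 0) (restrict x {1..m})) \<in> borel_measurable (distr M (\<Pi>\<^sub>M l\<in>{0..m}. N) V)" by simp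
  qed
  also have "distr M (\<Pi>\<^sub>M l\<in>{0..m}. N) V = (\<Pi>\<^sub>M l\<in>{0..m}. P)"
    unfolding V_def[abs_def] by (rule distr_reindex) (use inj in auto)
  also have "(\<integral>\<^sup>+x. G (x 0) (restrict x {1..m}) \<partial>(\<Pi>\<^sub>M l\<in>{0..m}. P)) = (\<integral>\<^sup>+z. \<integral>\<^sup>+w. G z w \<partial>(\<Pi>\<^sub>M l\<in>{1..m}. P) \<partial>P)"
    by (rule nn_integral_split_test_point[OF G])
  finally show ?thesis .
qed

text \<open>\<open>replaced\<close> takes its fresh copy from index \<open>Suc m\<close>, so one
  vector over \<open>{0..Suc m}\<close> carries test point, training vector and copy. Splitting off
  \<open>Suc m\<close> and then 0 turns each summand of a stability into an iterated integral of a
  resampling difference, the form that Efron--Stein delivers.\<close>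

lemma nn_integral_initvec_replaced:
  fixes G :: "'z \<Rightarrow> (nat \<Rightarrow> 'z) \<Rightarrow> 'z \<Rightarrow> ennreal"
  assumes G: "(\<lambda>((z, w), y). G z w y) \<in> borel_measurable ((N \<Otimes>\<^sub>M (\<Pi>\<^sub>M l\<in>{1..m}. N)) \<Otimes>\<^sub>M N)"
  shows "(\<integral>\<^sup>+\<omega>. G (Z 0 \<omega>) (initvec Z m \<omega>) (Z (Suc m) \<omega>) \<partial>M)
    = (\<integral>\<^sup>+z. \<integral>\<^sup>+w. \<integral>\<^sup>+y. G z w y \<partial>P \<partial>(\<Pi>\<^sub>M l\<in>{1..m}. P) \<partial>P)"
proof -
  interpret P: prob_space P by (rule prob_space_P)
  interpret PP: product_prob_space "\<lambda>_::nat. P" "{0..m}" by (rule product_prob_space_P)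
  define V where "V \<omega> = (\<lambda>l\<in>{0..Suc m}. Z l \<omega>)" for \<omega>
  have V[measurable]: "V \<in> M \<rightarrow>\<^sub>M (\<Pi>\<^sub>M l\<in>{0..Suc m}. N)"
    unfolding V_def[abs_def] by (intro measurable_restrict Z_measurable)
  have meas: "(\<lambda>x. G (x 0) (restrict x {1..m}) (x (Suc m))) \<in> borel_measurable (\<Pi>\<^sub>M l\<in>{0..Suc m}. N)"
  proof -
    have "(\<lambda>x. ((x 0, restrict x {1..m}), x (Suc m))) \<in> (\<Pi>\<^sub>M l\<in>{0..Suc m}. N) \<rightarrow>\<^sub>M (N \<Otimes>\<^sub>M (\<Pi>\<^sub>M l\<in>{1..m}. N)) \<Otimes>\<^sub>M N"
      by (intro measurable_Pair measurable_restrict) auto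
    from measurable_compose[OF this G] show ?thesis by simp
  qed
  have L: "{0..Suc m} = insert (Suc m) {0..m}" by auto
  have "G (Z 0 \<omega>) (initvec Z m \<omega>) (Z (Suc m) \<omega>) = G (V \<omega> 0) (restrict (V \<omega>) {1..m}) (V \<omega> (Suc m))" for \<omega>
  proof -
    have "initvec Z m \<omega> = restrict (V \<omega>) {1..m}"
      unfolding initvec_def V_def by (auto simp: fun_eq_iff)
    then show ?thesis by (simp add: V_def)
  qed
  then have "(\<integral>\<^sup>+\<omega>. G (Z 0 \<omega>) (initvec Z m \<omega>) (Z (Suc m) \<omega>) \<partial>M)
      = (\<integral>\<^sup>+x. G (x 0) (restrict x {1..m}) (x (Suc m)) \<partial>distr M (\<Pi>\<^sub>M l\<in>{0..Suc m}. N) V)"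
    using meas by (simp add: nn_integral_distr[OF V])
  also have "distr M (\<Pi>\<^sub>M l\<in>{0..Suc m}. N) V = (\<Pi>\<^sub>M l\<in>{0..Suc m}. P)"
    unfolding V_def[abs_def] by (rule distr_reindex) auto
  also have "(\<integral>\<^sup>+x. G (x 0) (restrict x {1..m}) (x (Suc m)) \<partial>(\<Pi>\<^sub>M l\<in>{0..Suc m}. P))
      = (\<integral>\<^sup>+x. \<integral>\<^sup>+y. G (x 0) (restrict x {1..m}) y \<partial>P \<partial>(\<Pi>\<^sub>M l\<in>{0..m}. P))"
  proof -
    have "sets (\<Pi>\<^sub>M l\<in>insert (Suc m) {0..m}. P) = sets (\<Pi>\<^sub>M l\<in>{0..Suc m}. N)"
      unfolding L by (rule sets_PiM_P)
    then have meas': "(\<lambda>x. G (x 0) (restrict x {1..m}) (x (Suc m))) \<in> borel_measurable (\<Pi>\<^sub>M l\<in>insert (Suc m) {0..m}. P)"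
      using meas by (simp cong: measurable_cong_sets)
    have "restrict (x(Suc m := y)) {1..m} = restrict x {1..m}" for x :: "nat \<Rightarrow> 'z" and y
      by (auto simp: restrict_def fun_eq_iff)
    moreover have "finite {0..m}" "Suc m \<notin> {0..m}" by simp_all
    from PP.product_nn_integral_insert[OF this meas']
    have "(\<integral>\<^sup>+x. G (x 0) (restrict x {1..m}) (x (Suc m)) \<partial>(\<Pi>\<^sub>M l\<in>{0..Suc m}. P))
      = (\<integral>\<^sup>+x. \<integral>\<^sup>+y. G ((x(Suc m := y)) 0) (restrict (x(Suc m := y)) {1..m}) ((x(Suc m := y)) (Suc m)) \<partial>P \<partial>(\<Pi>\<^sub>M l\<in>{0..m}. P))"
      unfolding L .
    ultimately show ?thesis by simp
  qed
  also have "\<dots> = (\<integral>\<^sup>+z. \<integral>\<^sup>+w. \<integral>\<^sup>+y. G z w y \<partial>P \<partial>(\<Pi>\<^sub>M l\<in>{1..m}. P) \<partial>P)"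
  proof (rule nn_integral_split_test_point[where G = "\<lambda>z w. \<integral>\<^sup>+y. G z w y \<partial>P"])
    have "(\<lambda>((z, w), y). G z w y) \<in> borel_measurable ((N \<Otimes>\<^sub>M (\<Pi>\<^sub>M l\<in>{1..m}. N)) \<Otimes>\<^sub>M P)"
      using G by (simp cong: measurable_cong_sets sets_pair_measure_cong)
    then have "(\<lambda>(x, y). G (fst x) (snd x) y) \<in> borel_measurable ((N \<Otimes>\<^sub>M (\<Pi>\<^sub>M l\<in>{1..m}. N)) \<Otimes>\<^sub>M P)"
      by (simp add: split_beta' case_prod_beta)
    from P.borel_measurable_nn_integral[OF this]
    show "(\<lambda>(z, w). \<integral>\<^sup>+y. G z w y \<partial>P) \<in> borel_measurable (N \<Otimes>\<^sub>M (\<Pi>\<^sub>M l\<in>{1..m}. N))"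
      by (simp add: case_prod_beta)
  qed
  finally show ?thesis .
qed

section \<open>Independence from the past and martingale transforms\<close>

lemma indep_var_comp:
  fixes u :: "'z \<Rightarrow> real" and G :: "(nat \<Rightarrow> 'z) \<Rightarrow> real"
  assumes u: "u \<in> borel_measurable N" and G: "G \<in> borel_measurable (\<Pi>\<^sub>M l\<in>A. N)" and a: "a \<notin> A"
  shows "indep_var borel (\<lambda>\<omega>. u (Z a \<omega>)) borel (\<lambda>\<omega>. G (\<lambda>l\<in>A. Z l \<omega>))"
proof -
  have "indep_var (PiM {a} (\<lambda>_. N)) (\<lambda>\<omega>. restrict (\<lambda>i. Z i \<omega>) {a}) (PiM A (\<lambda>_. N)) (\<lambda>\<omega>. restrict (\<lambda>i. Z i \<omega>) A)"
    by (rule indep_var_restrict[OF indep]) (use a in auto)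
  moreover have "(\<lambda>f. u (f a)) \<in> borel_measurable (PiM {a} (\<lambda>_. N))"
    using u by measurable
  ultimately have "indep_var borel ((\<lambda>f. u (f a)) \<circ> (\<lambda>\<omega>. restrict (\<lambda>i. Z i \<omega>) {a})) borel (G \<circ> (\<lambda>\<omega>. restrict (\<lambda>i. Z i \<omega>) A))"
    using G by (rule indep_var_compose)
  then show ?thesis by (simp add: comp_def)
qed

text \<open>The summands are martingale differences, hence orthogonal.\<close>

lemma martingale_transform_square:
  fixes u :: "'z \<Rightarrow> real" and G :: "nat \<Rightarrow> (nat \<Rightarrow> 'z) \<Rightarrow> real"
  assumes u[measurable]: "u \<in> borel_measurable N" and u2: "integrable P (\<lambda>z. (u z)\<^sup>2)" and u0: "(LINT z|P. u z) = 0"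
    and G: "\<And>i. i \<in> {1..n} \<Longrightarrow> G i \<in> borel_measurable (\<Pi>\<^sub>M l\<in>{1..<i}. N)"
    and G2: "\<And>i. i \<in> {1..n} \<Longrightarrow> integrable M (\<lambda>\<omega>. (G i (\<lambda>l\<in>{1..<i}. Z l \<omega>))\<^sup>2)"
  shows "integrable M (\<lambda>\<omega>. (\<Sum>i\<in>{1..n}. u (Z i \<omega>) * G i (\<lambda>l\<in>{1..<i}. Z l \<omega>))\<^sup>2) \<and>
    expectation (\<lambda>\<omega>. (\<Sum>i\<in>{1..n}. u (Z i \<omega>) * G i (\<lambda>l\<in>{1..<i}. Z l \<omega>))\<^sup>2)
      = (LINT z|P. (u z)\<^sup>2) * (\<Sum>i\<in>{1..n}. expectation (\<lambda>\<omega>. (G i (\<lambda>l\<in>{1..<i}. Z l \<omega>))\<^sup>2))"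
  using G G2
proof (induction n)
  case 0
  then show ?case by simp
next
  case (Suc n)
  interpret P: prob_space P by (rule prob_space_P)
  \<comment> \<open>The partial sum and the next weight are both written as functionals of the same
    vector of the first \<open>n\<close> observations, so one independence statement covers their
    product in the cross term.\<close>
  define W where "W x = (\<Sum>i\<in>{1..n}. u (x i) * G i (restrict x {1..<i}))" for x
  define V where "V \<omega> = (\<lambda>l\<in>{1..<Suc n}. Z l \<omega>)" for \<omega>
  define H where "H = G (Suc n)"
  have W_V: "W (V \<omega>) = (\<Sum>i\<in>{1..n}. u (Z i \<omega>) * G i (\<lambda>l\<in>{1..<i}. Z l \<omega>))" for \<omega>
    unfolding W_def V_def
    by (intro sum.cong arg_cong2[where f = "(*)"] arg_cong2[where f = G] arg_cong[where f = u])
      (auto simp: fun_eq_iff)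
  have V[measurable]: "V \<in> M \<rightarrow>\<^sub>M (\<Pi>\<^sub>M l\<in>{1..<Suc n}. N)"
    unfolding V_def[abs_def] by (intro measurable_restrict Z_measurable)
  have W[measurable]: "W \<in> borel_measurable (\<Pi>\<^sub>M l\<in>{1..<Suc n}. N)"
    unfolding W_def[abs_def]
  proof (intro borel_measurable_sum borel_measurable_times)
    fix i assume i: "i \<in> {1..n}"
    have "(\<lambda>x. x i) \<in> (\<Pi>\<^sub>M l\<in>{1..<Suc n}. N) \<rightarrow>\<^sub>M N" using i by (intro measurable_component_singleton) auto
    from measurable_compose[OF this u] show "(\<lambda>x. u (x i)) \<in> borel_measurable (\<Pi>\<^sub>M l\<in>{1..<Suc n}. N)" .
    have Gi: "G i \<in> borel_measurable (\<Pi>\<^sub>M l\<in>{1..<i}. N)" using Suc.prems(1)[of i] i by simp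
    have "(\<lambda>x. restrict x {1..<i}) \<in> (\<Pi>\<^sub>M l\<in>{1..<Suc n}. N) \<rightarrow>\<^sub>M (\<Pi>\<^sub>M l\<in>{1..<i}. N)"
      using i by (intro measurable_restrict measurable_component_singleton) auto
    from measurable_compose[OF this Gi]
    show "(\<lambda>x. G i (restrict x {1..<i})) \<in> borel_measurable (\<Pi>\<^sub>M l\<in>{1..<Suc n}. N)" .
  qed
  have H[measurable]: "H \<in> borel_measurable (\<Pi>\<^sub>M l\<in>{1..<Suc n}. N)"
    unfolding H_def by (rule Suc.prems(1)) simp
  have IH: "integrable M (\<lambda>\<omega>. (\<Sum>i\<in>{1..n}. u (Z i \<omega>) * G i (\<lambda>l\<in>{1..<i}. Z l \<omega>))\<^sup>2) \<and>
    expectation (\<lambda>\<omega>. (\<Sum>i\<in>{1..n}. u (Z i \<omega>) * G i (\<lambda>l\<in>{1..<i}. Z l \<omega>))\<^sup>2)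
      = (LINT z|P. (u z)\<^sup>2) * (\<Sum>i\<in>{1..n}. expectation (\<lambda>\<omega>. (G i (\<lambda>l\<in>{1..<i}. Z l \<omega>))\<^sup>2))"
  proof (rule Suc.IH)
    fix i assume "i \<in> {1..n}"
    then have i: "i \<in> {1..Suc n}" by simp
    show "G i \<in> borel_measurable (\<Pi>\<^sub>M l\<in>{1..<i}. N)" by (rule Suc.prems(1)[OF i])
    show "integrable M (\<lambda>\<omega>. (G i (\<lambda>l\<in>{1..<i}. Z l \<omega>))\<^sup>2)" by (rule Suc.prems(2)[OF i])
  qed
  have iW: "integrable M (\<lambda>\<omega>. (W (V \<omega>))\<^sup>2)"
    and eW: "expectation (\<lambda>\<omega>. (W (V \<omega>))\<^sup>2)
      = (LINT z|P. (u z)\<^sup>2) * (\<Sum>i\<in>{1..n}. expectation (\<lambda>\<omega>. (G i (\<lambda>l\<in>{1..<i}. Z l \<omega>))\<^sup>2))"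
    using IH unfolding W_V by blast+
  have iH: "integrable M (\<lambda>\<omega>. (H (V \<omega>))\<^sup>2)"
    unfolding H_def V_def by (rule Suc.prems(2)) simp
  have iu: "integrable P u"
    by (rule P.square_integrable_imp_integrable) (use u2 in auto)
  have iuZ: "integrable M (\<lambda>\<omega>. u (Z (Suc n) \<omega>))" "integrable M (\<lambda>\<omega>. (u (Z (Suc n) \<omega>))\<^sup>2)"
    using iu u2 integrable_Z[of u] integrable_Z[of "\<lambda>z. (u z)\<^sup>2"] by auto
  have iWH: "integrable M (\<lambda>\<omega>. W (V \<omega>) * H (V \<omega>))"
  proof (rule Bochner_Integration.integrable_bound[of _ "\<lambda>\<omega>. (W (V \<omega>))\<^sup>2 + (H (V \<omega>))\<^sup>2"])
    have "\<bar>a * b\<bar> \<le> a\<^sup>2 + b\<^sup>2" for a b :: real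
    proof -
      have "0 \<le> (a + b)\<^sup>2" "0 \<le> (a - b)\<^sup>2" "0 \<le> a\<^sup>2" "0 \<le> b\<^sup>2" by simp_all
      then show ?thesis unfolding power2_sum power2_diff by (intro abs_leI) linarith+
    qed
    then show "AE \<omega> in M. norm (W (V \<omega>) * H (V \<omega>)) \<le> norm ((W (V \<omega>))\<^sup>2 + (H (V \<omega>))\<^sup>2)"
      by simp
  qed (use iW iH in auto)
  have ind1: "indep_var borel (\<lambda>\<omega>. u (Z (Suc n) \<omega>)) borel (\<lambda>\<omega>. W (V \<omega>) * H (V \<omega>))"
    unfolding V_def by (rule indep_var_comp[where G = "\<lambda>x. W x * H x", OF u borel_measurable_times[OF W H]]) simp
  have ind2: "indep_var borel (\<lambda>\<omega>. (u (Z (Suc n) \<omega>))\<^sup>2) borel (\<lambda>\<omega>. (H (V \<omega>))\<^sup>2)"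
    unfolding V_def by (rule indep_var_comp[where G = "\<lambda>x. (H x)\<^sup>2" and u = "\<lambda>z. (u z)\<^sup>2",
          OF borel_measurable_power[OF u] borel_measurable_power[OF H]]) simp
  note i1 = indep_var_integrable[OF ind1 iuZ(1) iWH] and i2 = indep_var_integrable[OF ind2 iuZ(2) iH]
  have e1: "expectation (\<lambda>\<omega>. u (Z (Suc n) \<omega>) * (W (V \<omega>) * H (V \<omega>))) = 0"
    using indep_var_lebesgue_integral[OF ind1 iuZ(1) iWH] u0 integral_Z[OF u] by simp
  have e2: "expectation (\<lambda>\<omega>. (u (Z (Suc n) \<omega>))\<^sup>2 * (H (V \<omega>))\<^sup>2) = (LINT z|P. (u z)\<^sup>2) * expectation (\<lambda>\<omega>. (H (V \<omega>))\<^sup>2)"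
    using indep_var_lebesgue_integral[OF ind2 iuZ(2) iH] integral_Z[of "\<lambda>z. (u z)\<^sup>2"] by simp
  have eq: "(\<Sum>i\<in>{1..Suc n}. u (Z i \<omega>) * G i (\<lambda>l\<in>{1..<i}. Z l \<omega>))\<^sup>2
      = (W (V \<omega>))\<^sup>2 + 2 * (u (Z (Suc n) \<omega>) * (W (V \<omega>) * H (V \<omega>))) + (u (Z (Suc n) \<omega>))\<^sup>2 * (H (V \<omega>))\<^sup>2" for \<omega>
  proof -
    have "(\<Sum>i\<in>{1..Suc n}. u (Z i \<omega>) * G i (\<lambda>l\<in>{1..<i}. Z l \<omega>)) = W (V \<omega>) + u (Z (Suc n) \<omega>) * H (V \<omega>)"
      unfolding W_V by (simp add: H_def V_def)
    then show ?thesis by (simp add: power2_sum power_mult_distrib)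
  qed
  have eH: "expectation (\<lambda>\<omega>. (G (Suc n) (\<lambda>l\<in>{1..<Suc n}. Z l \<omega>))\<^sup>2) = expectation (\<lambda>\<omega>. (H (V \<omega>))\<^sup>2)"
    unfolding H_def V_def by simp
  show ?case
  proof (intro conjI)
    show "integrable M (\<lambda>\<omega>. (\<Sum>i\<in>{1..Suc n}. u (Z i \<omega>) * G i (\<lambda>l\<in>{1..<i}. Z l \<omega>))\<^sup>2)"
      unfolding eq using iW i1 i2 by (intro Bochner_Integration.integrable_add integrable_mult_right) auto
    have "expectation (\<lambda>\<omega>. (\<Sum>i\<in>{1..Suc n}. u (Z i \<omega>) * G i (\<lambda>l\<in>{1..<i}. Z l \<omega>))\<^sup>2)
      = expectation (\<lambda>\<omega>. (W (V \<omega>))\<^sup>2) + (LINT z|P. (u z)\<^sup>2) * expectation (\<lambda>\<omega>. (H (V \<omega>))\<^sup>2)"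
      unfolding eq using iW i1 i2 e1 e2 by simp
    then show "expectation (\<lambda>\<omega>. (\<Sum>i\<in>{1..Suc n}. u (Z i \<omega>) * G i (\<lambda>l\<in>{1..<i}. Z l \<omega>))\<^sup>2)
      = (LINT z|P. (u z)\<^sup>2) * (\<Sum>i\<in>{1..Suc n}. expectation (\<lambda>\<omega>. (G i (\<lambda>l\<in>{1..<i}. Z l \<omega>))\<^sup>2))"
      unfolding eW using eH by (simp add: distrib_left)
  qed
qed

end

section \<open>The within-fold quadratic form\<close>

text \<open>The argument depends on the fold as well as on the index, because the loss at
  \<open>i\<close> is evaluated with the training vector of fold \<open>j\<close>. The constants are
  arranged as in \<open>within_fold_var\<close>, so the two agree by unfolding.\<close>

definition fold_form :: "nat \<Rightarrow> nat \<Rightarrow> (nat \<Rightarrow> nat set) \<Rightarrow> (nat \<Rightarrow> nat \<Rightarrow> real) \<Rightarrow> real"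
  where "fold_form n k F x = (1 / real k) * (\<Sum>j\<in>{1..k}. (1 / (real n / real k - 1)) *
    (\<Sum>i\<in>F j. (x j i - (real k / real n) * (\<Sum>i'\<in>F j. x j i'))\<^sup>2))"

text \<open>These are the predecessors of \<open>i\<close> within its own fold. A sum over them
  involves only observations before \<open>i\<close>, hence is a predictable weight for the
  martingale transform.\<close>

definition earlier :: "nat \<Rightarrow> (nat \<Rightarrow> nat set) \<Rightarrow> nat \<Rightarrow> nat set"
  where "earlier k F i = {l. l < i \<and> (\<exists>j\<in>{1..k}. i \<in> F j \<and> l \<in> F j)}"

text \<open>Each unordered pair is charged to its larger index; adding a new maximum to the set
  creates exactly the pairs that end in it.\<close>

lemma square_sum_eq:
  fixes x :: "nat \<Rightarrow> real"
  assumes "finite A"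
  shows "(\<Sum>i\<in>A. x i)\<^sup>2 = (\<Sum>i\<in>A. (x i)\<^sup>2) + 2 * (\<Sum>i\<in>A. x i * (\<Sum>l\<in>{l\<in>A. l < i}. x l))"
  using assms
proof (induction A rule: finite_linorder_max_induct)
  case empty
  then show ?case by simp
next
  case (insert b A)
  have 1: "{l. (l = b \<or> l \<in> A) \<and> l < i} = {l \<in> A. l < i}" if "i \<in> A" for i
    using insert.hyps(2) that by auto
  have 2: "{l. (l = b \<or> l \<in> A) \<and> l < b} = A" using insert.hyps(2) by auto
  have "b \<notin> A" using insert.hyps(2) by auto
  then show ?case
    using insert.IH insert.hyps(1)
    by (simp add: 1 2 power2_sum cong: sum.cong)
qed

locale folds =
  fixes n k :: nat and F :: "nat \<Rightarrow> nat set"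
  assumes k: "2 \<le> k" "k < n" "k dvd n"
    and card_F: "\<And>j. j \<in> {1..k} \<Longrightarrow> card (F j) = n div k"
    and disj: "disjoint_family_on F {1..k}"
    and Union_F: "(\<Union>j\<in>{1..k}. F j) = {1..n}"
begin

definition fold_size :: real where "fold_size = real n / real k"

lemma finite_F: "j \<in> {1..k} \<Longrightarrow> finite (F j)"
  using finite_subset[of "F j" "{1..n}"] Union_F by blast

lemma card_F_real: "j \<in> {1..k} \<Longrightarrow> real (card (F j)) = fold_size"
  using card_F k by (simp add: fold_size_def real_of_nat_div)

text \<open>Divisibility and \<open>k < n\<close> exclude the quotients 0 and 1. So
  \<open>fold_size - 1\<close> stays at least 1, and the bounds below do not degenerate for small
  folds.\<close>

lemma fold_size_ge_2: "2 \<le> fold_size"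
proof -
  from k obtain r where r: "n = k * r" by (auto simp: dvd_def)
  with k have "r \<noteq> 0" "r \<noteq> 1" by auto
  then have "r \<ge> 2" by simp
  moreover have "real n / real k = real r" using k r by simp
  ultimately show ?thesis by (simp add: fold_size_def)
qed

lemma sum_folds: "(\<Sum>j\<in>{1..k}. \<Sum>i\<in>F j. f i) = (\<Sum>i\<in>{1..n}. f i :: real)"
  unfolding Union_F[symmetric]
  by (rule sum.UNION_disjoint[symmetric]) (use finite_F disj in \<open>auto simp: disjoint_family_on_def\<close>)

lemma n_eq: "real n = real k * fold_size"
  using k by (simp add: fold_size_def)

lemma fold_form_altdef:
  "fold_form n k F x = (1 / (real k * (fold_size - 1))) * (\<Sum>j\<in>{1..k}. \<Sum>i\<in>F j. (x j i - (\<Sum>i'\<in>F j. x j i') / fold_size)\<^sup>2)"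
  unfolding fold_form_def fold_size_def[symmetric] sum_distrib_left[symmetric]
  by (simp add: fold_size_def mult_ac)

lemma fold_form_nonneg: "0 \<le> fold_form n k F x"
  unfolding fold_form_altdef using fold_size_ge_2 by (intro mult_nonneg_nonneg sum_nonneg) auto

text \<open>Centring within a fold removes any shift constant on that fold. The conditional risk at
  the training vector of fold \<open>j\<close> is such a shift, which is why stability of the
  centred loss suffices.\<close>

lemma fold_form_affine:
  assumes "\<And>j i. j \<in> {1..k} \<Longrightarrow> i \<in> F j \<Longrightarrow> x j i = s * y j i + c j"
  shows "fold_form n k F x = s\<^sup>2 * fold_form n k F y"
proof -
  have "(x j i - (\<Sum>i'\<in>F j. x j i') / fold_size)\<^sup>2 = s\<^sup>2 * (y j i - (\<Sum>i'\<in>F j. y j i') / fold_size)\<^sup>2"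
    if j: "j \<in> {1..k}" and i: "i \<in> F j" for i j
  proof -
    have "(\<Sum>i'\<in>F j. x j i') = s * (\<Sum>i'\<in>F j. y j i') + fold_size * c j"
      using assms[OF j] by (simp add: sum.distrib sum_distrib_left card_F_real[OF j])
    then have "x j i - (\<Sum>i'\<in>F j. x j i') / fold_size = s * (y j i - (\<Sum>i'\<in>F j. y j i') / fold_size)"
      using assms[OF j i] fold_size_ge_2 by (simp add: field_simps)
    then show ?thesis by (simp add: power_mult_distrib)
  qed
  then show ?thesis
    unfolding fold_form_altdef by (simp add: sum_distrib_left mult_ac)
qed

text \<open>Centring is linear, so the claim reduces termwise to \<open>\<bar>2 * a * b\<bar> \<le>
  \<eta> * a\<^sup>2 + b\<^sup>2 / \<eta>\<close>, the weighted inequality of arithmetic and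
  geometric means.\<close>

lemma fold_form_perturb:
  assumes "0 < \<eta>"
  shows "\<bar>fold_form n k F (\<lambda>j i. y j i + d j i) - fold_form n k F y\<bar>
    \<le> \<eta> * fold_form n k F y + (1 + 1 / \<eta>) * fold_form n k F d"
proof -
  have key: "\<bar>(a + b)\<^sup>2 - a\<^sup>2\<bar> \<le> \<eta> * a\<^sup>2 + (1 + 1 / \<eta>) * b\<^sup>2" for a b :: real
  proof -
    have "0 \<le> (sqrt \<eta> * a + b / sqrt \<eta>)\<^sup>2" "0 \<le> (sqrt \<eta> * a - b / sqrt \<eta>)\<^sup>2" by simp_all
    then have "2 * (a * b) \<le> \<eta> * a\<^sup>2 + b\<^sup>2 / \<eta>" "- 2 * (a * b) \<le> \<eta> * a\<^sup>2 + b\<^sup>2 / \<eta>"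
      using assms by (simp_all add: power2_sum power2_diff power_mult_distrib power_divide)
    moreover have "(a + b)\<^sup>2 - a\<^sup>2 = 2 * (a * b) + b\<^sup>2" by (simp add: power2_sum)
    moreover have "(1 + 1 / \<eta>) * b\<^sup>2 = b\<^sup>2 + b\<^sup>2 / \<eta>" by (simp add: distrib_right)
    ultimately show ?thesis using zero_le_power2[of b] unfolding abs_le_iff by linarith
  qed
  define Y where "Y j i = y j i - (\<Sum>i'\<in>F j. y j i') / fold_size" for j i
  define D where "D j i = d j i - (\<Sum>i'\<in>F j. d j i') / fold_size" for j i
  have YD: "y j i + d j i - (\<Sum>i'\<in>F j. y j i' + d j i') / fold_size = Y j i + D j i" for j i
    by (simp add: Y_def D_def sum.distrib add_divide_distrib)
  define K where "K = 1 / (real k * (fold_size - 1))"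
  have "K \<ge> 0" using fold_size_ge_2 by (simp add: K_def)
  have "\<bar>fold_form n k F (\<lambda>j i. y j i + d j i) - fold_form n k F y\<bar>
     = K * \<bar>\<Sum>j\<in>{1..k}. \<Sum>i\<in>F j. ((Y j i + D j i)\<^sup>2 - (Y j i)\<^sup>2)\<bar>"
    unfolding fold_form_altdef YD unfolding Y_def[symmetric] K_def[symmetric] sum_subtractf
      right_diff_distrib[symmetric] abs_mult using \<open>K \<ge> 0\<close> by simp
  also have "\<dots> \<le> K * (\<Sum>j\<in>{1..k}. \<Sum>i\<in>F j. \<bar>(Y j i + D j i)\<^sup>2 - (Y j i)\<^sup>2\<bar>)"
    using \<open>K \<ge> 0\<close> by (intro mult_left_mono order_trans[OF sum_abs] sum_mono) auto
  also have "\<dots> \<le> K * (\<Sum>j\<in>{1..k}. \<Sum>i\<in>F j. \<eta> * (Y j i)\<^sup>2 + (1 + 1 / \<eta>) * (D j i)\<^sup>2)"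
    using \<open>K \<ge> 0\<close> by (intro mult_left_mono sum_mono key) auto
  also have "\<dots> = \<eta> * fold_form n k F y + (1 + 1 / \<eta>) * fold_form n k F d"
    unfolding fold_form_altdef K_def[symmetric] Y_def[symmetric] D_def[symmetric]
    by (simp add: sum.distrib distrib_left sum_distrib_left mult_ac)
  finally show ?thesis .
qed

lemma sum_square_centred:
  assumes "j \<in> {1..k}"
  shows "(\<Sum>i\<in>F j. (x i - (\<Sum>i'\<in>F j. x i') / fold_size)\<^sup>2) = (\<Sum>i\<in>F j. (x i)\<^sup>2) - (\<Sum>i\<in>F j. x i)\<^sup>2 / fold_size"
proof -
  define s where "s = (\<Sum>i\<in>F j. x i)"
  have "(\<Sum>i\<in>F j. (x i - s / fold_size)\<^sup>2) = (\<Sum>i\<in>F j. (x i)\<^sup>2) - 2 * (s / fold_size) * (\<Sum>i\<in>F j. x i) + fold_size * (s / fold_size)\<^sup>2"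
    by (simp add: power2_diff sum.distrib sum_subtractf sum_distrib_left card_F_real[OF assms] sum_divide_distrib mult_ac)
  also have "\<dots> = (\<Sum>i\<in>F j. (x i)\<^sup>2) - s\<^sup>2 / fold_size"
    using fold_size_ge_2 by (simp add: s_def[symmetric] field_simps power2_eq_square)
  finally show ?thesis by (simp add: s_def)
qed

text \<open>Centring only decreases a sum of squares; the 2 bounds
  \<open>fold_size / (fold_size - 1)\<close>, with equality for folds of two points.\<close>

lemma fold_form_le: "fold_form n k F x \<le> 2 / real n * (\<Sum>j\<in>{1..k}. \<Sum>i\<in>F j. (x j i)\<^sup>2)"
proof -
  have "fold_form n k F x \<le> (1 / (real k * (fold_size - 1))) * (\<Sum>j\<in>{1..k}. \<Sum>i\<in>F j. (x j i)\<^sup>2)"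
    unfolding fold_form_altdef
    by (rule mult_left_mono[OF sum_mono]) (use fold_size_ge_2 in \<open>simp_all add: sum_square_centred\<close>)
  also have "\<dots> \<le> 2 / real n * (\<Sum>j\<in>{1..k}. \<Sum>i\<in>F j. (x j i)\<^sup>2)"
    unfolding n_eq using fold_size_ge_2 k
    by (intro mult_right_mono sum_nonneg) (simp_all add: field_simps)
  finally show ?thesis .
qed

section \<open>Diagonal and off-diagonal parts of the form\<close>

lemma earlier_eq: "j \<in> {1..k} \<Longrightarrow> i \<in> F j \<Longrightarrow> earlier k F i = {l \<in> F j. l < i}"
  using disj unfolding earlier_def disjoint_family_on_def by fast

lemma earlier_subset: "earlier k F i \<subseteq> {1..<i}"
  using Union_F unfolding earlier_def by fastforce

text \<open>An index is not its own predecessor; the resulting \<open>- 1\<close> matches the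
  denominator \<open>fold_size - 1\<close> of the off-diagonal term.\<close>

lemma card_earlier_le:
  assumes "i \<in> {1..n}"
  shows "real (card (earlier k F i)) \<le> fold_size - 1"
proof -
  obtain j where j: "j \<in> {1..k}" "i \<in> F j" using assms Union_F by blast
  have "card (earlier k F i) \<le> card (F j - {i})"
    unfolding earlier_eq[OF j] by (rule card_mono) (use finite_F[OF j(1)] in auto)
  also have "real \<dots> = fold_size - 1"
    using finite_F[OF j(1)] j card_F_real[OF j(1)] fold_size_ge_2 by (simp add: of_nat_diff Suc_leI card_gt_0_iff)
  finally show ?thesis by simp
qed

text \<open>The factor \<open>1 - 1 / fold_size\<close> left on the diagonal by centring cancels
  against \<open>fold_size - 1\<close>, so the squares have weight exactly \<open>1 / n\<close>
  whatever the fold size: the diagonal needs no bias correction.\<close>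

lemma fold_form_diag:
  "fold_form n k F (\<lambda>_. v) = (\<Sum>i\<in>{1..n}. (v i)\<^sup>2) / real n
    - 2 / (real n * (fold_size - 1)) * (\<Sum>i\<in>{1..n}. v i * (\<Sum>l\<in>earlier k F i. v l))"
proof -
  let ?P = "\<lambda>i. \<Sum>l\<in>earlier k F i. v l"
  have "(\<Sum>i\<in>F j. (v i - (\<Sum>i'\<in>F j. v i') / fold_size)\<^sup>2)
      = (1 - 1 / fold_size) * (\<Sum>i\<in>F j. (v i)\<^sup>2) - 2 / fold_size * (\<Sum>i\<in>F j. v i * ?P i)" if j: "j \<in> {1..k}" for j
  proof -
    have "(\<Sum>i\<in>F j. v i * (\<Sum>l\<in>{l\<in>F j. l < i}. v l)) = (\<Sum>i\<in>F j. v i * ?P i)"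
      by (intro sum.cong) (simp_all add: earlier_eq[OF j])
    then show ?thesis
      unfolding sum_square_centred[OF j] square_sum_eq[OF finite_F[OF j]]
      by (simp add: field_simps add_divide_distrib)
  qed
  then have "fold_form n k F (\<lambda>_. v) = (1 / (real k * (fold_size - 1))) *
      ((1 - 1 / fold_size) * (\<Sum>i\<in>{1..n}. (v i)\<^sup>2) - 2 / fold_size * (\<Sum>i\<in>{1..n}. v i * ?P i))"
    unfolding fold_form_altdef by (simp add: sum_subtractf sum_distrib_left[symmetric] sum_divide_distrib[symmetric] sum_folds del: One_nat_def)
  also have "\<dots> = (\<Sum>i\<in>{1..n}. (v i)\<^sup>2) / real n - 2 / (real n * (fold_size - 1)) * (\<Sum>i\<in>{1..n}. v i * ?P i)"
    unfolding n_eq using fold_size_ge_2 k by (simp add: divide_simps)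
  finally show ?thesis .
qed

text \<open>The free parameter \<open>\<eta>\<close> trades the accuracy of the bound against the weight of the error terms.\<close>

lemma fold_form_error_bound:
  fixes v :: "nat \<Rightarrow> real" and d :: "nat \<Rightarrow> nat \<Rightarrow> real"
  assumes p: "p = 1 \<or> p = 2" and \<eta>: "0 < \<eta>" "\<eta> \<le> 1"
  defines "R \<equiv> 2 / (real n * (fold_size - 1)) * (\<Sum>i\<in>{1..n}. v i * (\<Sum>l\<in>earlier k F i. v l))"
  shows "\<bar>fold_form n k F (\<lambda>j i. v i + d j i) - 1\<bar> ^ p \<le> 4 * \<eta> + 64 / \<eta>\<^sup>2 *
    (\<bar>(\<Sum>i\<in>{1..n}. (v i)\<^sup>2) / real n - 1\<bar> ^ p + R\<^sup>2
      + (\<Sum>j\<in>{1..k}. \<Sum>i\<in>F j. (d j i) ^ (2 * p)) / real n)"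
proof -
  define A where "A = (\<Sum>i\<in>{1..n}. (v i)\<^sup>2) / real n"
  define S where "S = (\<Sum>j\<in>{1..k}. \<Sum>i\<in>F j. (d j i)\<^sup>2) / real n"
  define T where "T = (\<Sum>j\<in>{1..k}. \<Sum>i\<in>F j. (d j i) ^ (2 * p)) / real n"
  let ?X = "fold_form n k F (\<lambda>j i. v i + d j i)"
  have S0: "0 \<le> S" by (auto simp: S_def intro!: sum_nonneg divide_nonneg_nonneg)
  have Q: "fold_form n k F (\<lambda>_. v) = A - R" by (simp add: fold_form_diag A_def R_def)
  have QD: "fold_form n k F d \<le> 2 * S" using fold_form_le[of d] by (simp add: S_def)
  have "\<bar>?X - (A - R)\<bar> \<le> \<eta> * (A - R) + (1 + 1 / \<eta>) * fold_form n k F d"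
    using fold_form_perturb[OF \<eta>(1), of "\<lambda>_. v" d] by (simp add: Q)
  \<comment> \<open>Since \<open>A - R\<close> is close to 1 when \<open>A - 1\<close> and
    \<open>R\<close> are small, the relative error \<open>\<eta> * (A - R)\<close> becomes an
    absolute one.\<close>
  also have "\<dots> \<le> \<eta> * (1 + \<bar>A - 1\<bar> + \<bar>R\<bar>) + (2 / \<eta>) * (2 * S)"
  proof (intro add_mono mult_left_mono mult_mono QD)
    show "1 + 1 / \<eta> \<le> 2 / \<eta>" using \<eta> by (simp add: field_simps)
  qed (use \<eta> S0 fold_form_nonneg in \<open>auto simp: abs_if\<close>)
  also have "\<eta> * (1 + \<bar>A - 1\<bar> + \<bar>R\<bar>) \<le> \<eta> + \<bar>A - 1\<bar> + \<bar>R\<bar>"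
    using \<eta> mult_right_mono[of \<eta> 1 "\<bar>A - 1\<bar>"] mult_right_mono[of \<eta> 1 "\<bar>R\<bar>"] by (simp add: distrib_left)
  finally have "\<bar>?X - (A - R)\<bar> \<le> \<eta> + \<bar>A - 1\<bar> + \<bar>R\<bar> + 4 / \<eta> * S" by simp
  moreover have "\<bar>?X - 1\<bar> \<le> \<bar>?X - (A - R)\<bar> + \<bar>A - 1\<bar> + \<bar>R\<bar>" by arith
  ultimately have main: "\<bar>?X - 1\<bar> \<le> \<eta> + 2 * \<bar>A - 1\<bar> + 2 * \<bar>R\<bar> + 4 / \<eta> * S" by linarith
  have e1: "1 / \<eta> \<le> 1 / \<eta>\<^sup>2" "1 \<le> 1 / \<eta>\<^sup>2"
    using \<eta> by (simp_all add: field_simps power2_eq_square power_le_one mult_le_one)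
  \<comment> \<open>A common weight for all error terms. The number 64 is
    \<open>4 * 4\<^sup>2\<close>, from squaring \<open>4 / \<eta> * S\<close> inside a sum of four
    terms.\<close>
  have e2: "2 \<le> 64 / \<eta>\<^sup>2" "1 / \<eta> \<le> 64 / \<eta>\<^sup>2" "4 / \<eta> \<le> 64 / \<eta>\<^sup>2" "16 \<le> 64 / \<eta>\<^sup>2"
  proof -
    have "64 / \<eta>\<^sup>2 = 64 * (1 / \<eta>\<^sup>2)" "4 / \<eta> = 4 * (1 / \<eta>)" by simp_all
    with e1 show "2 \<le> 64 / \<eta>\<^sup>2" "1 / \<eta> \<le> 64 / \<eta>\<^sup>2" "4 / \<eta> \<le> 64 / \<eta>\<^sup>2" "16 \<le> 64 / \<eta>\<^sup>2"
      by linarith+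
  qed
  have "\<bar>?X - 1\<bar> ^ p \<le> 4 * \<eta> + 64 / \<eta>\<^sup>2 * (\<bar>A - 1\<bar> ^ p + R\<^sup>2 + T)"
    using p
  proof
    assume p: "p = 1"
    \<comment> \<open>Only the second moment of \<open>R\<close> will be controlled, so
      \<open>2 * \<bar>R\<bar>\<close> is traded for
      \<open>\<eta> + R\<^sup>2 / \<eta>\<close>.\<close>
    have "0 \<le> (\<bar>R\<bar> - \<eta>)\<^sup>2" by simp
    then have "2 * \<bar>R\<bar> * \<eta> \<le> \<eta> * \<eta> + R\<^sup>2"
      by (simp add: power2_diff power2_eq_square algebra_simps)
    then have "2 * \<bar>R\<bar> \<le> \<eta> + 1 / \<eta> * R\<^sup>2"
      using \<eta> by (simp add: field_simps)
    with main have "\<bar>?X - 1\<bar> \<le> 4 * \<eta> + 2 * \<bar>A - 1\<bar> + 1 / \<eta> * R\<^sup>2 + 4 / \<eta> * S"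
      using \<eta> by linarith
    also have "\<dots> \<le> 4 * \<eta> + (64 / \<eta>\<^sup>2) * \<bar>A - 1\<bar> + (64 / \<eta>\<^sup>2) * R\<^sup>2 + (64 / \<eta>\<^sup>2) * S"
      using e2 S0 \<eta> by (intro add_mono mult_right_mono) auto
    finally show ?thesis using p by (simp add: T_def S_def distrib_left)
  next
    assume p: "p = 2"
    have sq4: "(a + b + c + e)\<^sup>2 \<le> 4 * (a\<^sup>2 + b\<^sup>2 + c\<^sup>2 + e\<^sup>2)" for a b c e :: real
    proof -
      have "0 \<le> (a - b)\<^sup>2 + (a - c)\<^sup>2 + (a - e)\<^sup>2 + (b - c)\<^sup>2 + (b - e)\<^sup>2 + (c - e)\<^sup>2" by simp
      then show ?thesis by (simp add: power2_eq_square algebra_simps)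
    qed
    \<comment> \<open>Cauchy--Schwarz against the constant 1 over all pairs of a fold and one of its
      members; there are \<open>n\<close> such pairs.\<close>
    have ST: "S\<^sup>2 \<le> T"
    proof -
      let ?I = "SIGMA j:{1..k}. F j"
      have fin: "finite ?I" using finite_F by auto
      have card: "real (card ?I) = real n"
        using finite_F by (subst card_SigmaI) (auto simp: card_F_real n_eq)
      have e: "(\<Sum>j\<in>{1..k}. \<Sum>i\<in>F j. g j i) = (\<Sum>(j,i)\<in>?I. g j i)" for g :: "nat \<Rightarrow> nat \<Rightarrow> real"
        using finite_F by (subst sum.Sigma) auto
      have "(\<Sum>(j,i)\<in>?I. (d j i)\<^sup>2)\<^sup>2 \<le> (\<Sum>x\<in>?I. 1\<^sup>2) * (\<Sum>(j,i)\<in>?I. ((d j i)\<^sup>2)\<^sup>2)"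
        using Cauchy_Schwarz_ineq_sum[of "\<lambda>_. 1" "\<lambda>(j,i). (d j i)\<^sup>2" ?I] by (simp add: case_prod_beta)
      also have "\<dots> = real n * (\<Sum>(j,i)\<in>?I. (d j i) ^ 4)"
        using card by simp
      finally show ?thesis
        unfolding S_def T_def e p using k by (simp add: power_divide field_simps power2_eq_square)
    qed
    have "\<bar>?X - 1\<bar>\<^sup>2 \<le> (\<eta> + 2 * \<bar>A - 1\<bar> + 2 * \<bar>R\<bar> + 4 / \<eta> * S)\<^sup>2"
      by (rule power_mono[OF main]) simp
    also have "\<dots> \<le> 4 * (\<eta>\<^sup>2 + (2 * \<bar>A - 1\<bar>)\<^sup>2 + (2 * \<bar>R\<bar>)\<^sup>2 + (4 / \<eta> * S)\<^sup>2)" by (rule sq4)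
    also have "\<dots> = 4 * \<eta>\<^sup>2 + 16 * \<bar>A - 1\<bar>\<^sup>2 + 16 * R\<^sup>2 + 64 / \<eta>\<^sup>2 * S\<^sup>2"
      by (simp add: power_mult_distrib power_divide)
    also have "\<dots> \<le> 4 * \<eta> + 64 / \<eta>\<^sup>2 * \<bar>A - 1\<bar>\<^sup>2 + 64 / \<eta>\<^sup>2 * R\<^sup>2 + 64 / \<eta>\<^sup>2 * T"
      using \<eta> e2 ST by (intro add_mono mult_mono) (auto simp: power2_eq_square mult_le_cancel_left1)
    finally show ?thesis using p by (simp add: distrib_left)
  qed
  then show ?thesis by (simp add: A_def T_def)
qed

end

section \<open>Moment bounds for the sample\<close>

context iid_sample
begin

lemma measure_P_space[simp]: "measure P (space N) = 1"
  using prob_space.prob_space[OF prob_space_P] by simp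

text \<open>The martingale identity with the nonrandom weights \<open>indicator E i\<close>.\<close>

lemma sum_square:
  fixes u :: "'z \<Rightarrow> real"
  assumes u: "u \<in> borel_measurable N" "integrable P (\<lambda>z. (u z)\<^sup>2)" "(LINT z|P. u z) = 0" and E: "E \<subseteq> {1..n}"
  shows "integrable M (\<lambda>\<omega>. (\<Sum>l\<in>E. u (Z l \<omega>))\<^sup>2)"
    and "expectation (\<lambda>\<omega>. (\<Sum>l\<in>E. u (Z l \<omega>))\<^sup>2) = (LINT z|P. (u z)\<^sup>2) * real (card E)"
proof -
  have eq: "(\<Sum>i\<in>{1..n}. f i * indicator E i) = (\<Sum>i\<in>E. f i)" for f :: "nat \<Rightarrow> real"
    using E by (simp add: sum.inter_restrict[symmetric] indicator_def if_distrib[of "\<lambda>x. _ * x"] Int_absorb1 cong: if_cong)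
  have "(\<Sum>i\<in>{1..n}. (indicator E i)\<^sup>2) = real (card E)"
    using eq[of "\<lambda>i. indicator E i"] by (simp add: power2_eq_square)
  then show "integrable M (\<lambda>\<omega>. (\<Sum>l\<in>E. u (Z l \<omega>))\<^sup>2)"
    "expectation (\<lambda>\<omega>. (\<Sum>l\<in>E. u (Z l \<omega>))\<^sup>2) = (LINT z|P. (u z)\<^sup>2) * real (card E)"
    using martingale_transform_square[OF u, of n "\<lambda>i _. indicator E i"]
    unfolding eq by (simp_all add: prob_space)
qed

text \<open>The weight at \<open>i\<close> has second moment \<open>card (earlier k F i)\<close>, at
  most \<open>fold_size - 1\<close>, so the transform has second moment at most
  \<open>n * (fold_size - 1)\<close>. The squared prefactor leaves
  \<open>4 / (n * (fold_size - 1))\<close>, and the remaining denominator is at least 1, which gives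
  a bound uniform in the number of folds.\<close>

lemma off_diagonal_bound:
  fixes u :: "'z \<Rightarrow> real"
  assumes F: "folds n k F"
    and u[measurable]: "u \<in> borel_measurable N" and u2: "integrable P (\<lambda>z. (u z)\<^sup>2)" "(LINT z|P. (u z)\<^sup>2) = 1"
    and u0: "(LINT z|P. u z) = 0"
  shows "(\<integral>\<^sup>+\<omega>. ennreal ((2 / (real n * (folds.fold_size n k - 1)) *
      (\<Sum>i\<in>{1..n}. u (Z i \<omega>) * (\<Sum>l\<in>earlier k F i. u (Z l \<omega>))))\<^sup>2) \<partial>M) \<le> ennreal (4 / real n)"
proof -
  interpret F: folds n k F by fact
  define G where "G i x = (\<Sum>l\<in>earlier k F i. u (x l))" for i and x :: "nat \<Rightarrow> 'z"
  have G_eq: "G i (\<lambda>l\<in>{1..<i}. Z l \<omega>) = (\<Sum>l\<in>earlier k F i. u (Z l \<omega>))" for i \<omega>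
    unfolding G_def using F.earlier_subset[of i] by (intro sum.cong) (auto simp: subset_iff)
  have G_meas: "G i \<in> borel_measurable (\<Pi>\<^sub>M l\<in>{1..<i}. N)" for i
    unfolding G_def[abs_def]
  proof (intro borel_measurable_sum)
    fix l assume "l \<in> earlier k F i"
    then have "l \<in> {1..<i}" using F.earlier_subset by blast
    from measurable_compose[OF measurable_component_singleton[OF this] u]
    show "(\<lambda>x. u (x l)) \<in> borel_measurable (\<Pi>\<^sub>M l\<in>{1..<i}. N)" .
  qed
  have sub: "earlier k F i \<subseteq> {1..i}" for i using F.earlier_subset[of i] by auto
  have G2: "integrable M (\<lambda>\<omega>. (G i (\<lambda>l\<in>{1..<i}. Z l \<omega>))\<^sup>2)"
    "expectation (\<lambda>\<omega>. (G i (\<lambda>l\<in>{1..<i}. Z l \<omega>))\<^sup>2) = real (card (earlier k F i))" for i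
    unfolding G_eq using sum_square[OF u u2(1) u0 sub, of i] u2(2) by simp_all
  define s where "s = F.fold_size - 1"
  have s: "1 \<le> s" using F.fold_size_ge_2 by (simp add: s_def)
  have n: "0 < real n" using F.k by simp
  define X where "X \<omega> = (\<Sum>i\<in>{1..n}. u (Z i \<omega>) * G i (\<lambda>l\<in>{1..<i}. Z l \<omega>))" for \<omega>
  have X: "integrable M (\<lambda>\<omega>. (X \<omega>)\<^sup>2)"
    "expectation (\<lambda>\<omega>. (X \<omega>)\<^sup>2) = (\<Sum>i\<in>{1..n}. real (card (earlier k F i)))"
    using martingale_transform_square[OF u u2(1) u0, of n G] G_meas G2 u2(2) unfolding X_def by simp_all
  have "expectation (\<lambda>\<omega>. (X \<omega>)\<^sup>2) \<le> (\<Sum>i\<in>{1..n}. s)"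
    unfolding X s_def by (intro sum_mono F.card_earlier_le)
  then have EX: "expectation (\<lambda>\<omega>. (X \<omega>)\<^sup>2) \<le> real n * s" by simp
  have "(\<integral>\<^sup>+\<omega>. ennreal ((2 / (real n * s) * X \<omega>)\<^sup>2) \<partial>M)
      = ennreal ((2 / (real n * s))\<^sup>2 * expectation (\<lambda>\<omega>. (X \<omega>)\<^sup>2))"
    unfolding power_mult_distrib by (subst nn_integral_eq_integral) (use X(1) in auto)
  also have "\<dots> \<le> ennreal (4 / real n)"
  proof (rule ennreal_leI)
    have "(2 / (real n * s))\<^sup>2 * expectation (\<lambda>\<omega>. (X \<omega>)\<^sup>2) \<le> (2 / (real n * s))\<^sup>2 * (real n * s)"
      by (intro mult_left_mono EX) simp
    also have "\<dots> = 4 / real n * (1 / s)"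
      using s n by (simp add: power2_eq_square field_simps)
    also have "\<dots> \<le> 4 / real n * 1"
      using s by (intro mult_left_mono) auto
    finally show "(2 / (real n * s))\<^sup>2 * expectation (\<lambda>\<omega>. (X \<omega>)\<^sup>2) \<le> 4 / real n" by simp
  qed
  finally show ?thesis unfolding X_def s_def G_eq .
qed

text \<open>The variance of \<open>v\<^sup>2\<close> is its fourth moment minus 1, and averaging
  over \<open>n\<close> independent copies divides it by \<open>n\<close>. An infinite fourth moment
  makes the right-hand side infinite.\<close>

lemma diagonal_L2_bound:
  fixes v :: "'z \<Rightarrow> real"
  assumes n: "0 < n" and v[measurable]: "v \<in> borel_measurable N"
    and v2: "integrable P (\<lambda>z. (v z)\<^sup>2)" "(LINT z|P. (v z)\<^sup>2) = 1"
  shows "(\<integral>\<^sup>+\<omega>. ennreal (\<bar>(\<Sum>i\<in>{1..n}. (v (Z i \<omega>))\<^sup>2) / real n - 1\<bar> ^ 2) \<partial>M)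
    \<le> (\<integral>\<^sup>+z. ennreal (v z ^ 4) \<partial>P) / of_nat n"
proof (cases "(\<integral>\<^sup>+z. ennreal (v z ^ 4) \<partial>P) = \<infinity>")
  case True
  then show ?thesis using n by (simp add: ennreal_top_divide)
next
  case False
  interpret P: prob_space P by (rule prob_space_P)
  have i4: "integrable P (\<lambda>z. v z ^ 4)"
    by (rule integrableI_nonneg) (use False in \<open>auto simp: top.not_eq_extremum\<close>)
  define u where "u z = (v z)\<^sup>2 - 1" for z
  have um[measurable]: "u \<in> borel_measurable N" unfolding u_def by measurable
  have u0: "(LINT z|P. u z) = 0" unfolding u_def using v2 by simp
  have usq: "(u z)\<^sup>2 = v z ^ 4 - 2 * (v z)\<^sup>2 + 1" for z
    by (simp add: u_def power2_diff flip: power_mult)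
  have iu: "integrable P (\<lambda>z. (u z)\<^sup>2)" unfolding usq using v2 i4 by simp
  have Eu: "(LINT z|P. (u z)\<^sup>2) \<le> (LINT z|P. v z ^ 4)"
    unfolding usq using v2 i4 by simp
  define X where "X \<omega> = (\<Sum>i\<in>{1..n}. u (Z i \<omega>))" for \<omega>
  have X: "integrable M (\<lambda>\<omega>. (X \<omega>)\<^sup>2)" "expectation (\<lambda>\<omega>. (X \<omega>)\<^sup>2) = (LINT z|P. (u z)\<^sup>2) * real n"
    unfolding X_def using sum_square[OF um iu u0, of "{1..n}" n] by simp_all
  have "\<bar>(\<Sum>i\<in>{1..n}. (v (Z i \<omega>))\<^sup>2) / real n - 1\<bar> ^ 2 = (1 / (real n)\<^sup>2) * (X \<omega>)\<^sup>2" for \<omega>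
  proof -
    have "(\<Sum>i\<in>{1..n}. (v (Z i \<omega>))\<^sup>2) / real n - 1 = X \<omega> / real n"
      using n by (simp add: X_def u_def sum_subtractf field_simps)
    then show ?thesis by (simp add: power_divide)
  qed
  then have "(\<integral>\<^sup>+\<omega>. ennreal (\<bar>(\<Sum>i\<in>{1..n}. (v (Z i \<omega>))\<^sup>2) / real n - 1\<bar> ^ 2) \<partial>M)
    = (\<integral>\<^sup>+\<omega>. ennreal ((1 / (real n)\<^sup>2) * (X \<omega>)\<^sup>2) \<partial>M)" by simp
  also have "\<dots> = ennreal ((1 / (real n)\<^sup>2) * expectation (\<lambda>\<omega>. (X \<omega>)\<^sup>2))"
    by (subst nn_integral_eq_integral) (use X(1) in auto)
  also have "\<dots> \<le> ennreal ((LINT z|P. v z ^ 4) / real n)"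
    unfolding X(2) using Eu n by (intro ennreal_leI) (simp add: power2_eq_square divide_right_mono)
  also have "\<dots> = (\<integral>\<^sup>+z. ennreal (v z ^ 4) \<partial>P) / of_nat n"
    using n by (subst nn_integral_eq_integral[OF i4]) (auto simp: divide_ennreal[symmetric] ennreal_of_nat_eq_real_of_nat)
  finally show ?thesis .
qed

text \<open>Truncate \<open>v\<^sup>2\<close> at level \<open>a\<close>: the bounded part obeys the \<open>L\<^sup>2\<close> law of large numbers.\<close>

lemma diagonal_L1_bound:
  fixes v :: "'z \<Rightarrow> real"
  assumes n: "0 < n" and v[measurable]: "v \<in> borel_measurable N"
    and v2: "integrable P (\<lambda>z. (v z)\<^sup>2)" "(LINT z|P. (v z)\<^sup>2) = 1"
    and a: "0 < a" and \<eta>: "0 < \<eta>"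
  shows "(\<integral>\<^sup>+\<omega>. ennreal \<bar>(\<Sum>i\<in>{1..n}. (v (Z i \<omega>))\<^sup>2) / real n - 1\<bar> \<partial>M)
    \<le> ennreal (\<eta> + a / (\<eta> * real n)) + 2 * (\<integral>\<^sup>+z. ennreal ((v z)\<^sup>2 * indicator {a<..} ((v z)\<^sup>2)) \<partial>P)"
proof -
  interpret P: prob_space P by (rule prob_space_P)
  define T where "T z = (v z)\<^sup>2 * indicator {..a} ((v z)\<^sup>2)" for z
  define L where "L z = (v z)\<^sup>2 * indicator {a<..} ((v z)\<^sup>2)" for z
  have [measurable]: "T \<in> borel_measurable N" "L \<in> borel_measurable N"
    unfolding T_def L_def by measurable
  have TL: "(v z)\<^sup>2 = T z + L z" for z by (auto simp: T_def L_def indicator_def)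
  have T0: "0 \<le> T z" "T z \<le> a" and L0: "0 \<le> L z" for z
    using a by (auto simp: T_def L_def indicator_def)
  have iT: "integrable P T" by (rule P.integrable_const_bound[of _ a]) (use T0 in auto)
  have iL: "integrable P L"
    by (rule Bochner_Integration.integrable_bound[OF v2(1)]) (auto simp: L_def indicator_def)
  define t l where "t = (LINT z|P. T z)" and "l = (LINT z|P. L z)"
  have l0: "0 \<le> l" unfolding l_def using L0 by (intro Bochner_Integration.integral_nonneg) auto
  have tl: "t + l = 1" using v2(2) iT iL unfolding TL t_def l_def by simp
  then have t_eq: "t = 1 - l" by simp
  define u where "u z = T z - t" for z
  have um[measurable]: "u \<in> borel_measurable N" unfolding u_def by measurable
  have u0: "(LINT z|P. u z) = 0" unfolding u_def t_def using iT by simp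
  have iT2: "integrable P (\<lambda>z. (T z)\<^sup>2)"
    by (rule P.integrable_const_bound[of _ "a\<^sup>2"]) (use T0 in \<open>auto intro!: power_mono\<close>)
  have usq: "(u z)\<^sup>2 = (T z)\<^sup>2 - 2 * t * T z + t\<^sup>2" for z
    by (simp add: u_def power2_diff mult_ac)
  have iu: "integrable P (\<lambda>z. (u z)\<^sup>2)" unfolding usq using iT iT2 by simp
  \<comment> \<open>Linear growth in \<open>a\<close> comes from
    \<open>T\<^sup>2 \<le> a * T\<close> together with \<open>t \<le> 1\<close>.\<close>
  have Eu: "(LINT z|P. (u z)\<^sup>2) \<le> a"
  proof -
    have "(LINT z|P. (u z)\<^sup>2) = (LINT z|P. (T z)\<^sup>2) - t\<^sup>2"
      unfolding usq using iT iT2 by (simp add:  t_def[symmetric] power2_eq_square)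
    also have "\<dots> \<le> (LINT z|P. (T z)\<^sup>2)" by simp
    also have "\<dots> \<le> (LINT z|P. a * T z)"
      using iT iT2 T0 by (intro integral_mono) (auto simp: power2_eq_square intro: mult_right_mono)
    also have "\<dots> = a * t" using iT by (simp add: t_def)
    also have "\<dots> \<le> a" using tl l0 a by (simp add: mult_le_cancel_left1)
    finally show ?thesis .
  qed
  define X where "X \<omega> = (\<Sum>i\<in>{1..n}. u (Z i \<omega>))" for \<omega>
  have Xm[measurable]: "X \<in> borel_measurable M" unfolding X_def by measurable
  have X: "integrable M (\<lambda>\<omega>. (X \<omega>)\<^sup>2)" "expectation (\<lambda>\<omega>. (X \<omega>)\<^sup>2) = (LINT z|P. (u z)\<^sup>2) * real n"
    unfolding X_def using sum_square[OF um iu u0, of "{1..n}" n] by simp_all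
  have n': "0 < real n" using n by simp
  \<comment> \<open>The part above level \<open>a\<close> is charged twice, once through its sample
    average and once through \<open>l = 1 - t\<close>, the mean lost by truncation. This is the
    factor 2 in the bound.\<close>
  have "\<bar>(\<Sum>i\<in>{1..n}. (v (Z i \<omega>))\<^sup>2) / real n - 1\<bar>
    \<le> \<eta> + (1 / (\<eta> * (real n)\<^sup>2)) * (X \<omega>)\<^sup>2 + (1 / real n) * (\<Sum>i\<in>{1..n}. L (Z i \<omega>)) + l" for \<omega>
  proof -
    have "(\<Sum>i\<in>{1..n}. (v (Z i \<omega>))\<^sup>2) / real n - 1 = X \<omega> / real n + (\<Sum>i\<in>{1..n}. L (Z i \<omega>)) / real n - l"
    proof -
      have "(\<Sum>i\<in>{1..n}. (v (Z i \<omega>))\<^sup>2) = X \<omega> + real n * t + (\<Sum>i\<in>{1..n}. L (Z i \<omega>))"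
        by (simp add: X_def u_def TL sum_subtractf sum.distrib)
      then show ?thesis using n' t_eq by (simp add: add_divide_distrib)
    qed
    moreover have "0 \<le> (\<Sum>i\<in>{1..n}. L (Z i \<omega>)) / real n"
      using L0 by (intro divide_nonneg_nonneg sum_nonneg) auto
    moreover have "\<bar>X \<omega> / real n\<bar> \<le> \<eta> + (1 / (\<eta> * (real n)\<^sup>2)) * (X \<omega>)\<^sup>2"
    proof -
      define y where "y = \<bar>X \<omega> / real n\<bar>"
      have "0 \<le> y\<^sup>2 + \<eta>\<^sup>2 - 2 * y * \<eta>" by (simp only: power2_diff[symmetric] zero_le_power2)
      moreover have "0 \<le> y * \<eta>" using \<eta> by (simp add: y_def)
      ultimately have "y * \<eta> \<le> \<eta>\<^sup>2 + y\<^sup>2" by linarith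
      then have "y \<le> \<eta> + y\<^sup>2 / \<eta>" using \<eta> by (simp add: field_simps power2_eq_square)
      also have "y\<^sup>2 / \<eta> = (1 / (\<eta> * (real n)\<^sup>2)) * (X \<omega>)\<^sup>2" by (simp add: y_def power_divide)
      finally show ?thesis by (simp add: y_def)
    qed
    moreover have "\<bar>x + y - l\<bar> \<le> \<bar>x\<bar> + y + l" if "0 \<le> y" for x y
      using that l0 by arith
    moreover have "(1 / real n) * y = y / real n" for y by simp
    ultimately show ?thesis by (smt (verit))
  qed
  then have "(\<integral>\<^sup>+\<omega>. ennreal \<bar>(\<Sum>i\<in>{1..n}. (v (Z i \<omega>))\<^sup>2) / real n - 1\<bar> \<partial>M)
    \<le> (\<integral>\<^sup>+\<omega>. ennreal (\<eta> + (1 / (\<eta> * (real n)\<^sup>2)) * (X \<omega>)\<^sup>2 + (1 / real n) * (\<Sum>i\<in>{1..n}. L (Z i \<omega>)) + l) \<partial>M)"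
    by (intro nn_integral_mono ennreal_leI)
  also have "\<dots> = ennreal (expectation (\<lambda>\<omega>. \<eta> + (1 / (\<eta> * (real n)\<^sup>2)) * (X \<omega>)\<^sup>2 + (1 / real n) * (\<Sum>i\<in>{1..n}. L (Z i \<omega>)) + l))"
    using X(1) iL integrable_Z[of L] \<eta> l0 L0
    by (intro nn_integral_eq_integral) (auto intro!: add_nonneg_nonneg sum_nonneg divide_nonneg_nonneg)
  also have "expectation (\<lambda>\<omega>. \<eta> + (1 / (\<eta> * (real n)\<^sup>2)) * (X \<omega>)\<^sup>2 + (1 / real n) * (\<Sum>i\<in>{1..n}. L (Z i \<omega>)) + l)
    = \<eta> + (1 / (\<eta> * (real n)\<^sup>2)) * expectation (\<lambda>\<omega>. (X \<omega>)\<^sup>2) + (1 / real n) * (\<Sum>i\<in>{1..n}. l) + l"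
    using X(1) iL integrable_Z[of L] integral_Z[of L] by (simp add: prob_space l_def)
  also have "\<dots> \<le> \<eta> + a / (\<eta> * real n) + 2 * l"
  proof -
    have "(1 / (\<eta> * (real n)\<^sup>2)) * expectation (\<lambda>\<omega>. (X \<omega>)\<^sup>2) \<le> (1 / (\<eta> * (real n)\<^sup>2)) * (a * real n)"
      unfolding X(2) using \<eta> by (intro mult_left_mono mult_right_mono Eu) auto
    also have "\<dots> = a / (\<eta> * real n)" using n' by (simp add: power2_eq_square)
    finally show ?thesis using n' by simp
  qed
  also have "ennreal (\<eta> + a / (\<eta> * real n) + 2 * l) = ennreal (\<eta> + a / (\<eta> * real n)) + 2 * ennreal l"
    using \<eta> a l0 by (simp add: ennreal_plus ennreal_mult)
  also have "ennreal l = (\<integral>\<^sup>+z. ennreal (L z) \<partial>P)"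
    unfolding l_def using iL L0 by (intro nn_integral_eq_integral[symmetric]) auto
  finally show ?thesis by (simp add: L_def ennreal_leI)
qed

end

section \<open>Stability bounds the centred loss\<close>

context iid_sample
begin

lemma test_train_measurable: "(\<lambda>\<omega>. (Z 0 \<omega>, initvec Z m \<omega>)) \<in> M \<rightarrow>\<^sub>M N \<Otimes>\<^sub>M (\<Pi>\<^sub>M l\<in>{1..m}. N)"
  by (rule measurable_Pair[OF Z_measurable initvec_measurable])

text \<open>Tested on indicators. Having the joint law as a product measure makes Fubini available
  for the signed loss.\<close>

lemma distr_pair:
  "distr M (N \<Otimes>\<^sub>M (\<Pi>\<^sub>M l\<in>{1..m}. N)) (\<lambda>\<omega>. (Z 0 \<omega>, initvec Z m \<omega>)) = P \<Otimes>\<^sub>M (\<Pi>\<^sub>M l\<in>{1..m}. P)"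
proof (rule measure_eqI)
  let ?Q = "\<Pi>\<^sub>M l\<in>{1..m}. P" and ?D = "distr M (N \<Otimes>\<^sub>M (\<Pi>\<^sub>M l\<in>{1..m}. N)) (\<lambda>\<omega>. (Z 0 \<omega>, initvec Z m \<omega>))"
  have setsQ: "sets ?Q = sets (\<Pi>\<^sub>M l\<in>{1..m}. N)" by (rule sets_PiM_P)
  show sets: "sets ?D = sets (P \<Otimes>\<^sub>M ?Q)"
    using setsQ by (simp cong: sets_pair_measure_cong)
  fix A assume "A \<in> sets ?D"
  then have A: "A \<in> sets (N \<Otimes>\<^sub>M (\<Pi>\<^sub>M l\<in>{1..m}. N))" "A \<in> sets (P \<Otimes>\<^sub>M ?Q)" using sets by auto
  interpret Q: prob_space ?Q by (rule prob_space_PiM) (rule prob_space_P)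
  have "emeasure ?D A = (\<integral>\<^sup>+x. indicator A x \<partial>?D)"
    using A(1) by (intro nn_integral_indicator[symmetric]) simp
  also have "\<dots> = (\<integral>\<^sup>+\<omega>. indicator A (Z 0 \<omega>, initvec Z m \<omega>) \<partial>M)"
    using A(1) by (intro nn_integral_distr[OF test_train_measurable]) simp
  also have "\<dots> = (\<integral>\<^sup>+z. \<integral>\<^sup>+w. indicator A (z, w) \<partial>?Q \<partial>P)"
    unfolding initvec_eq_subvec
    by (rule nn_integral_subvec[where G = "\<lambda>z w. indicator A (z, w)"]) (use A in auto)
  also have "\<dots> = emeasure (P \<Otimes>\<^sub>M ?Q) A"
    by (rule Q.emeasure_pair_measure[OF A(2), symmetric])
  finally show "emeasure ?D A = emeasure (P \<Otimes>\<^sub>M ?Q) A" .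
qed

context
  fixes m :: nat and h :: "'z \<Rightarrow> (nat \<Rightarrow> 'z) \<Rightarrow> real"
  assumes m: "1 \<le> m"
    and h_meas: "(\<lambda>(z, w). h z w) \<in> borel_measurable (N \<Otimes>\<^sub>M (\<Pi>\<^sub>M l\<in>{1..m}. N))"
    and h_int: "integrable M (\<lambda>\<omega>. h (Z 0 \<omega>) (initvec Z m \<omega>))"
begin

lemma h_measurable[measurable (raw)]:
  assumes "f \<in> L \<rightarrow>\<^sub>M N" "g \<in> L \<rightarrow>\<^sub>M (\<Pi>\<^sub>M l\<in>{1..m}. N)"
  shows "(\<lambda>x. h (f x) (g x)) \<in> borel_measurable L"
  using measurable_compose[OF measurable_Pair[OF assms] h_meas] by simp

lemma mean_loss_measurable[measurable]: "mean_loss M Z m h \<in> borel_measurable N"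
  unfolding mean_loss_def[abs_def] by measurable

lemma cond_risk_measurable[measurable]: "cond_risk M N Z m h \<in> borel_measurable (\<Pi>\<^sub>M l\<in>{1..m}. N)"
  using is_cond_risk_cond_risk[OF prob_space_axioms indep h_meas h_int] by (simp add: is_cond_risk_def)

lemma centred_loss_measurable[measurable (raw)]:
  assumes "f \<in> L \<rightarrow>\<^sub>M N" "g \<in> L \<rightarrow>\<^sub>M (\<Pi>\<^sub>M l\<in>{1..m}. N)"
  shows "(\<lambda>x. centred_loss M N Z m h (f x) (g x)) \<in> borel_measurable L"
  unfolding centred_loss_def using assms by measurable

lemma subvec_measurable: "length b = m \<Longrightarrow> subvec Z b \<in> M \<rightarrow>\<^sub>M (\<Pi>\<^sub>M l\<in>{1..m}. N)"
  unfolding subvec_def[abs_def] by (erule ssubst) (intro measurable_restrict Z_measurable)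

text \<open>\<open>cond_risk\<close> is an arbitrary version, known only almost everywhere along
  \<open>initvec\<close>. Its integrability and mean are therefore read off from the conditional
  expectation and transferred to the product law.\<close>

lemma cond_risk_integral:
  shows "integrable (\<Pi>\<^sub>M l\<in>{1..m}. P) (cond_risk M N Z m h)"
    and "(LINT w|(\<Pi>\<^sub>M l\<in>{1..m}. P). cond_risk M N Z m h w) = expectation (\<lambda>\<omega>. h (Z 0 \<omega>) (initvec Z m \<omega>))"
proof -
  let ?V = "initvec Z m" and ?c = "cond_risk M N Z m h"
  let ?F = "vimage_algebra (space M) ?V (\<Pi>\<^sub>M l\<in>{1..m}. N)"
  have sub: "subalgebra M ?F"
    using sets_image_in_sets[OF _ initvec_measurable[of m]] by (auto simp: subalgebra_def)
  interpret fin_sub: finite_measure_subalgebra M ?F by standard (rule sub)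
  have AE: "AE \<omega> in M. ?c (?V \<omega>) = real_cond_exp M ?F (\<lambda>\<omega>. h (Z 0 \<omega>) (?V \<omega>)) \<omega>"
    using is_cond_risk_cond_risk[OF prob_space_axioms indep h_meas h_int] by (simp add: is_cond_risk_def)
  have i: "integrable M (\<lambda>\<omega>. ?c (?V \<omega>))"
    using fin_sub.real_cond_exp_int(1)[OF h_int] AE
    by (subst integrable_cong_AE[OF _ _ AE]) auto
  have e: "expectation (\<lambda>\<omega>. ?c (?V \<omega>)) = expectation (\<lambda>\<omega>. h (Z 0 \<omega>) (?V \<omega>))"
    unfolding fin_sub.real_cond_exp_int(2)[OF h_int, symmetric]
    by (rule integral_cong_AE[OF _ _ AE]) auto
  show "integrable (\<Pi>\<^sub>M l\<in>{1..m}. P) ?c"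
    unfolding distr_initvec[OF m, symmetric] 
    by (rule integrable_distr_eq[OF initvec_measurable cond_risk_measurable, THEN iffD2, OF i])
  show "(LINT w|(\<Pi>\<^sub>M l\<in>{1..m}. P). ?c w) = expectation (\<lambda>\<omega>. h (Z 0 \<omega>) (?V \<omega>))"
    unfolding distr_initvec[OF m, symmetric] e[symmetric]
    by (rule integral_distr[OF initvec_measurable cond_risk_measurable])
qed

lemma mean_loss_eq: "z \<in> space N \<Longrightarrow> mean_loss M Z m h z = (LINT w|(\<Pi>\<^sub>M l\<in>{1..m}. P). h z w)"
  unfolding mean_loss_def distr_initvec[OF m, symmetric]
  by (rule integral_distr[OF initvec_measurable, symmetric]) (auto intro!: h_measurable)

lemma loss_integrable_pair: "integrable (P \<Otimes>\<^sub>M (\<Pi>\<^sub>M l\<in>{1..m}. P)) (\<lambda>(z, w). h z w)"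
  unfolding distr_pair[symmetric] using h_int by (subst integrable_distr_eq[OF test_train_measurable h_meas]) simp

text \<open>By Fubini, the mean loss has the same overall mean as the loss, which is also the mean
  of \<open>cond_risk\<close>; so subtracting the conditional risk shifts \<open>mean_loss z\<close>
  by exactly this constant.\<close>

lemma expectation_mean_loss:
  "expectation (\<lambda>\<omega>. mean_loss M Z m h (Z 0 \<omega>)) = expectation (\<lambda>\<omega>. h (Z 0 \<omega>) (initvec Z m \<omega>))"
proof -
  let ?Q = "\<Pi>\<^sub>M l\<in>{1..m}. P"
  interpret P: prob_space P by (rule prob_space_P)
  interpret Q: prob_space ?Q by (rule prob_space_PiM) (rule prob_space_P)
  interpret PQ: pair_sigma_finite P ?Q ..
  have "expectation (\<lambda>\<omega>. mean_loss M Z m h (Z 0 \<omega>)) = (LINT z|P. mean_loss M Z m h z)"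
    by (rule integral_Z) simp
  also have "\<dots> = (LINT z|P. LINT w|?Q. h z w)"
    by (rule Bochner_Integration.integral_cong) (auto simp: mean_loss_eq)
  also have "\<dots> = (LINT x|(P \<Otimes>\<^sub>M ?Q). (case x of (z, w) \<Rightarrow> h z w))"
    using PQ.integral_fst[of h] loss_integrable_pair by simp
  also have "\<dots> = expectation (\<lambda>\<omega>. h (Z 0 \<omega>) (initvec Z m \<omega>))"
    unfolding distr_pair[symmetric] by (subst integral_distr[OF test_train_measurable h_meas]) simp
  finally show ?thesis .
qed

text \<open>Conditionally on the test point, the centred loss is a function of the training vector with
  mean \<open>mean_loss z - E (mean_loss (Z 0))\<close>, to which the Efron--Stein inequality applies.\<close>

lemma centred_loss_moment_bound:
  assumes q: "q = 1 \<or> q = 2"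
  shows "(\<integral>\<^sup>+z. \<integral>\<^sup>+w. ennreal ((centred_loss M N Z m h z w
        - (mean_loss M Z m h z - expectation (\<lambda>\<omega>. mean_loss M Z m h (Z 0 \<omega>)))) ^ (2 * q)) \<partial>(\<Pi>\<^sub>M l\<in>{1..m}. P) \<partial>P)
    \<le> ennreal (57 * real m ^ q) * ((\<Sum>i\<in>{1..m}. \<integral>\<^sup>+\<omega>. ennreal ((centred_loss M N Z m h (Z 0 \<omega>) (initvec Z m \<omega>)
        - centred_loss M N Z m h (Z 0 \<omega>) (replaced Z m i \<omega>)) ^ (2 * q)) \<partial>M) / of_nat m)"
proof -
  let ?Q = "\<Pi>\<^sub>M l\<in>{1..m}. P" and ?H = "centred_loss M N Z m h" and ?\<mu> = "expectation (\<lambda>\<omega>. mean_loss M Z m h (Z 0 \<omega>))"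
  interpret P: prob_space P by (rule prob_space_P)
  interpret Q: prob_space ?Q by (rule prob_space_PiM) (rule prob_space_P)
  interpret PQ: pair_sigma_finite P ?Q ..
  \<comment> \<open>The influence of training coordinate \<open>i\<close> when the test point is
    fixed at \<open>z\<close>.\<close>
  define \<Delta> where "\<Delta> z i = (\<integral>\<^sup>+w. \<integral>\<^sup>+y. ennreal ((?H z w - ?H z (w(i := y))) ^ (2 * q)) \<partial>P \<partial>?Q)" for z i
  have upd: "(\<lambda>x. (v x)(i := w x)) \<in> L \<rightarrow>\<^sub>M (\<Pi>\<^sub>M l\<in>{1..m}. N)"
    if "v \<in> L \<rightarrow>\<^sub>M (\<Pi>\<^sub>M l\<in>{1..m}. N)" "w \<in> L \<rightarrow>\<^sub>M N" "i \<in> {1..m}" for i v w and L :: "'x measure"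
    by (rule measurable_fun_upd[where J = "{1..m}"]) (use that in auto)
  have Gm: "(\<lambda>((z, w), y). ennreal ((?H z w - ?H z (w(i := y))) ^ (2 * q)))
      \<in> borel_measurable ((N \<Otimes>\<^sub>M (\<Pi>\<^sub>M l\<in>{1..m}. N)) \<Otimes>\<^sub>M N)" if i: "i \<in> {1..m}" for i
  proof -
    have u: "(\<lambda>x. (snd (fst x))(i := snd x)) \<in> (N \<Otimes>\<^sub>M (\<Pi>\<^sub>M l\<in>{1..m}. N)) \<Otimes>\<^sub>M N \<rightarrow>\<^sub>M (\<Pi>\<^sub>M l\<in>{1..m}. N)"
      by (rule upd) (use i in auto)
    have "(\<lambda>x. ?H (fst (fst x)) (snd (fst x)) - ?H (fst (fst x)) ((snd (fst x))(i := snd x)))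
      \<in> borel_measurable ((N \<Otimes>\<^sub>M (\<Pi>\<^sub>M l\<in>{1..m}. N)) \<Otimes>\<^sub>M N)"
      by (intro borel_measurable_diff centred_loss_measurable u) auto
    then show ?thesis by (simp add: split_beta' case_prod_beta)
  qed
  have \<Delta>m: "(\<lambda>z. \<Delta> z i) \<in> borel_measurable P" if i: "i \<in> {1..m}" for i
  proof -
    have sets1: "sets ((N \<Otimes>\<^sub>M (\<Pi>\<^sub>M l\<in>{1..m}. N)) \<Otimes>\<^sub>M N) = sets ((N \<Otimes>\<^sub>M (\<Pi>\<^sub>M l\<in>{1..m}. N)) \<Otimes>\<^sub>M P)"
      by (rule sets_pair_measure_cong) simp_all
    have sets2: "sets (N \<Otimes>\<^sub>M (\<Pi>\<^sub>M l\<in>{1..m}. N)) = sets (P \<Otimes>\<^sub>M ?Q)"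
      by (rule sets_pair_measure_cong) (simp_all add: sets_PiM_P)
    have "(\<lambda>(x, y). ennreal ((?H (fst x) (snd x) - ?H (fst x) ((snd x)(i := y))) ^ (2 * q)))
        \<in> borel_measurable ((N \<Otimes>\<^sub>M (\<Pi>\<^sub>M l\<in>{1..m}. N)) \<Otimes>\<^sub>M P)"
      using Gm[OF i] unfolding measurable_cong_sets[OF sets1 refl] by (simp add: split_beta' case_prod_beta)
    from P.borel_measurable_nn_integral[OF this]
    have "(\<lambda>(z, w). \<integral>\<^sup>+y. ennreal ((?H z w - ?H z (w(i := y))) ^ (2 * q)) \<partial>P) \<in> borel_measurable (P \<Otimes>\<^sub>M ?Q)"
      unfolding measurable_cong_sets[OF sets2 refl] by (simp add: split_beta')
    from Q.borel_measurable_nn_integral[OF this] show ?thesis by (simp add: \<Delta>_def)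
  qed
  \<comment> \<open>Integrability of the loss over the training vector is only guaranteed for almost
    every test point, so Efron--Stein applies almost everywhere in \<open>z\<close>.\<close>
  have AE: "AE z in P. (\<integral>\<^sup>+w. ennreal ((?H z w - (mean_loss M Z m h z - ?\<mu>)) ^ (2 * q)) \<partial>?Q)
      \<le> ennreal (57 * real m ^ (q - 1)) * (\<Sum>i\<in>{1..m}. \<Delta> z i)"
    using PQ.AE_integrable_fst'[OF loss_integrable_pair] AE_space
  proof eventually_elim
    case (elim z)
    then have z: "z \<in> space N" and i: "integrable ?Q (\<lambda>w. h z w)" by simp_all
    have iH: "integrable ?Q (?H z)"
      unfolding centred_loss_def[abs_def] using i cond_risk_integral(1) by simp
    have "(LINT w|?Q. ?H z w) = mean_loss M Z m h z - ?\<mu>"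
      unfolding centred_loss_def using i cond_risk_integral z
      by (simp add: mean_loss_eq expectation_mean_loss)
    moreover have "{1..m} \<noteq> {}" using m by simp
    ultimately show ?case
      using P.efron_stein_2_4[OF q _ _ iH] unfolding \<Delta>_def by simp
  qed
  have "(\<integral>\<^sup>+z. \<integral>\<^sup>+w. ennreal ((?H z w - (mean_loss M Z m h z - ?\<mu>)) ^ (2 * q)) \<partial>?Q \<partial>P)
     \<le> (\<integral>\<^sup>+z. ennreal (57 * real m ^ (q - 1)) * (\<Sum>i\<in>{1..m}. \<Delta> z i) \<partial>P)"
    by (rule nn_integral_mono_AE[OF AE])
  also have "\<dots> = ennreal (57 * real m ^ (q - 1)) * (\<integral>\<^sup>+z. (\<Sum>i\<in>{1..m}. \<Delta> z i) \<partial>P)"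
    by (intro nn_integral_cmult borel_measurable_sum \<Delta>m)
  also have "(\<integral>\<^sup>+z. (\<Sum>i\<in>{1..m}. \<Delta> z i) \<partial>P) = (\<Sum>i\<in>{1..m}. \<integral>\<^sup>+z. \<Delta> z i \<partial>P)"
    by (intro nn_integral_sum \<Delta>m)
  also have "(\<Sum>i\<in>{1..m}. \<integral>\<^sup>+z. \<Delta> z i \<partial>P) = (\<Sum>i\<in>{1..m}. \<integral>\<^sup>+\<omega>. ennreal ((?H (Z 0 \<omega>) (initvec Z m \<omega>)
        - ?H (Z 0 \<omega>) (replaced Z m i \<omega>)) ^ (2 * q)) \<partial>M)"
    unfolding \<Delta>_def replaced_def by (intro sum.cong refl nn_integral_initvec_replaced[symmetric] Gm)
  \<comment> \<open>Passing from the sum over coordinates to the average in the stability supplies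
    the last power of \<open>m\<close>.\<close>
  also have "ennreal (57 * real m ^ (q - 1)) * \<dots> = ennreal (57 * real m ^ q) * (\<dots> / of_nat m)"
  proof -
    have "real m ^ q = real m ^ (q - 1) * real m" using q by (auto simp: power2_eq_square)
    then have "ennreal (57 * real m ^ q) = ennreal (57 * real m ^ (q - 1)) * of_nat m"
      by (simp add: ennreal_mult ennreal_of_nat_eq_real_of_nat mult.assoc)
    moreover have "of_nat m * (x / of_nat m) = x" for x :: ennreal
      using m by (simp add: ennreal_times_divide mult.commute[of "of_nat m"] mult_divide_eq_ennreal)
    ultimately show ?thesis by (simp add: mult.assoc)
  qed
  finally show ?thesis .
qed

end

end

section \<open>Consistency of the within-fold variance estimator\<close>

text \<open>The finite-sample estimate for both assertions. The three error terms are the diagonal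
  fluctuation, the off-diagonal part, and the stability in units of \<open>s ^ p / n ^ p\<close>;
  the weight \<open>64 / \<eta>\<^sup>2\<close> does not depend on \<open>n\<close>, on the number
  of folds or on the loss.\<close>

lemma (in iid_sample) within_fold_var_bound:
  fixes h :: "'z \<Rightarrow> (nat \<Rightarrow> 'z) \<Rightarrow> real"
  assumes p: "p = 1 \<or> p = 2" and \<eta>: "0 < \<eta>" "\<eta> \<le> 1"
    and k: "2 \<le> k" "k < n" "k dvd n" and m: "m = train_size n k" and splits: "cv_splits n k B B'"
    and h_meas: "(\<lambda>(z, w). h z w) \<in> borel_measurable (N \<Otimes>\<^sub>M (\<Pi>\<^sub>M l\<in>{1..m}. N))"
    and h_int: "integrable M (\<lambda>\<omega>. h (Z 0 \<omega>) (initvec Z m \<omega>))"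
    and \<mu>: "\<mu> = expectation (\<lambda>\<omega>. mean_loss M Z m h (Z 0 \<omega>))"
    and v: "\<And>z. v z = (mean_loss M Z m h z - \<mu>) / sqrt s"
    and s: "0 < s" and v2: "integrable P (\<lambda>z. (v z)\<^sup>2)" "(LINT z|P. (v z)\<^sup>2) = 1" "(LINT z|P. v z) = 0"
  shows "within_fold_var Z n k B B' h \<in> borel_measurable M"
    and "(\<integral>\<^sup>+\<omega>. ennreal (\<bar>within_fold_var Z n k B B' h \<omega> / s - 1\<bar> ^ p) \<partial>M)
      \<le> ennreal (4 * \<eta>) + ennreal (64 / \<eta>\<^sup>2) *
        ((\<integral>\<^sup>+\<omega>. ennreal (\<bar>(\<Sum>i\<in>{1..n}. (v (Z i \<omega>))\<^sup>2) / real n - 1\<bar> ^ p) \<partial>M) + ennreal (4 / real n)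
          + ennreal 57 * ((\<Sum>i\<in>{1..m}. \<integral>\<^sup>+\<omega>. ennreal ((centred_loss M N Z m h (Z 0 \<omega>) (initvec Z m \<omega>)
              - centred_loss M N Z m h (Z 0 \<omega>) (replaced Z m i \<omega>)) ^ (2 * p)) \<partial>M) / of_nat m / ennreal (s ^ p / real n ^ p)))"
proof -
  define F where "F j = set (B' j)" for j
  interpret F: folds n k F
    using k splits unfolding cv_splits_def F_def
    by unfold_locales (auto simp: distinct_card)
  have nk: "k * (n div k) = n"
    using k by simp
  have n0: "0 < real n" using k by simp
  have m1: "1 \<le> m" "m \<le> n"
  proof -
    have "n div k < n" using k by simp
    then show "1 \<le> m" "m \<le> n" unfolding m train_size_def by auto
  qed
  note mlm[measurable] = mean_loss_measurable[OF m1(1) h_meas h_int]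
  note hm = h_measurable[OF m1(1) h_meas h_int]
  note clm = centred_loss_measurable[OF m1(1) h_meas h_int]
  have vm[measurable]: "v \<in> borel_measurable N" unfolding v by measurable
  \<comment> \<open>The loss is \<open>sqrt s * (v + d) + c\<close>: the shift \<open>c j\<close> is
    constant on fold \<open>j\<close>, and \<open>dd\<close> is the standardised deviation of the
    centred loss from its mean over the training vector.\<close>
  define c where "c j \<omega> = cond_risk M N Z m h (subvec Z (B j) \<omega>)" for j \<omega>
  define dd where "dd z w = (centred_loss M N Z m h z w - (mean_loss M Z m h z - \<mu>)) / sqrt s" for z w
  define d where "d \<omega> j i = dd (Z i \<omega>) (subvec Z (B j) \<omega>)" for \<omega> j i
  have B: "distinct (B j)" "length (B j) = m" if "j \<in> {1..k}" for j
    using splits that unfolding cv_splits_def m by auto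
  \<comment> \<open>The validation index lies outside its own training vector; this gives the pair
    the law of \<open>(Z 0, initvec Z m)\<close>.\<close>
  have notin: "i \<notin> set (B j)" if "j \<in> {1..k}" "i \<in> F j" for i j
    using splits that unfolding cv_splits_def F_def by blast
  have sv: "subvec Z (B j) \<in> M \<rightarrow>\<^sub>M (\<Pi>\<^sub>M l\<in>{1..m}. N)" if "j \<in> {1..k}" for j
    using subvec_measurable[OF m1(1) h_meas h_int B(2)[OF that]] .
  have wfv: "within_fold_var Z n k B B' h \<omega> = fold_form n k F (\<lambda>j i. h (Z i \<omega>) (subvec Z (B j) \<omega>))" for \<omega>
    unfolding within_fold_var_def fold_form_def F_def ..
  show "within_fold_var Z n k B B' h \<in> borel_measurable M"
    unfolding within_fold_var_def[abs_def]
    by (intro borel_measurable_times borel_measurable_const borel_measurable_sum borel_measurable_power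
        borel_measurable_diff hm Z_measurable sv)
  have "h (Z i \<omega>) (subvec Z (B j) \<omega>) = sqrt s * (v (Z i \<omega>) + d \<omega> j i) + c j \<omega>" for \<omega> j i
    using s by (simp add: d_def dd_def v c_def centred_loss_def add_divide_distrib[symmetric])
  then have scaled: "within_fold_var Z n k B B' h \<omega> / s = fold_form n k F (\<lambda>j i. v (Z i \<omega>) + d \<omega> j i)" for \<omega>
    using s unfolding wfv by (subst F.fold_form_affine[where s = "sqrt s" and c = "\<lambda>j. c j \<omega>"]) auto
  define R where "R \<omega> = 2 / (real n * (F.fold_size - 1)) *
    (\<Sum>i\<in>{1..n}. v (Z i \<omega>) * (\<Sum>l\<in>earlier k F i. v (Z l \<omega>)))" for \<omega>
  define A where "A \<omega> = (\<Sum>i\<in>{1..n}. (v (Z i \<omega>))\<^sup>2) / real n" for \<omega>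
  define T where "T \<omega> = (\<Sum>j\<in>{1..k}. \<Sum>i\<in>F j. (d \<omega> j i) ^ (2 * p)) / real n" for \<omega>
  have [measurable]: "A \<in> borel_measurable M" "R \<in> borel_measurable M"
    unfolding A_def R_def by measurable
  have ddm: "(\<lambda>(z, w). dd z w) \<in> borel_measurable (N \<Otimes>\<^sub>M (\<Pi>\<^sub>M l\<in>{1..m}. N))"
    unfolding dd_def case_prod_beta
    by (intro borel_measurable_divide borel_measurable_diff clm borel_measurable_const measurable_fst measurable_snd
        measurable_compose[OF measurable_fst mlm])
  have dm: "(\<lambda>\<omega>. d \<omega> j i) \<in> borel_measurable M" if "j \<in> {1..k}" for i j
    using measurable_compose[OF measurable_Pair[OF Z_measurable sv[OF that]] ddm] by (simp add: d_def)
  have Tm[measurable]: "T \<in> borel_measurable M"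
    unfolding T_def[abs_def] by (intro borel_measurable_divide borel_measurable_sum borel_measurable_power dm) auto
  define \<gamma> where "\<gamma> = (\<Sum>i\<in>{1..m}. \<integral>\<^sup>+\<omega>. ennreal ((centred_loss M N Z m h (Z 0 \<omega>) (initvec Z m \<omega>)
              - centred_loss M N Z m h (Z 0 \<omega>) (replaced Z m i \<omega>)) ^ (2 * p)) \<partial>M) / of_nat m"
  have ev: "0 \<le> (x::real) ^ (2 * p)" for x by (simp add: power_mult)
  have moment: "(\<integral>\<^sup>+\<omega>. ennreal ((d \<omega> j i) ^ (2 * p)) \<partial>M) \<le> ennreal 57 * (\<gamma> / ennreal (s ^ p / real n ^ p))"
    if j: "j \<in> {1..k}" and i: "i \<in> F j" for i j
  proof -
    let ?Q = "\<Pi>\<^sub>M l\<in>{1..m}. P"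
    let ?e = "\<lambda>z w. centred_loss M N Z m h z w - (mean_loss M Z m h z - \<mu>)"
    have "(\<integral>\<^sup>+\<omega>. ennreal ((d \<omega> j i) ^ (2 * p)) \<partial>M) = (\<integral>\<^sup>+z. \<integral>\<^sup>+w. ennreal ((dd z w) ^ (2 * p)) \<partial>?Q \<partial>P)"
      unfolding d_def
      by (rule nn_integral_subvec[where G = "\<lambda>z w. ennreal ((dd z w) ^ (2 * p))", OF B[OF j] notin[OF j i]])
        (use ddm in \<open>simp add: case_prod_beta\<close>)
    \<comment> \<open>Back to a single integral over the sample space, where the factor
      \<open>1 / s ^ p\<close> can be pulled out in one step before returning to the product
      measure.\<close>
    also have "\<dots> = (\<integral>\<^sup>+\<omega>. ennreal ((dd (Z 0 \<omega>) (initvec Z m \<omega>)) ^ (2 * p)) \<partial>M)"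
      unfolding initvec_eq_subvec
      by (rule nn_integral_subvec[where G = "\<lambda>z w. ennreal ((dd z w) ^ (2 * p))", symmetric])
        (use ddm in \<open>auto simp add: case_prod_beta\<close>)
    also have "\<dots> = (\<integral>\<^sup>+\<omega>. ennreal (1 / s ^ p) * ennreal ((?e (Z 0 \<omega>) (initvec Z m \<omega>)) ^ (2 * p)) \<partial>M)"
    proof (rule nn_integral_cong)
      fix \<omega>
      have "sqrt s ^ (2 * p) = s ^ p" using s by (simp add: power_mult)
      then show "ennreal ((dd (Z 0 \<omega>) (initvec Z m \<omega>)) ^ (2 * p))
        = ennreal (1 / s ^ p) * ennreal ((?e (Z 0 \<omega>) (initvec Z m \<omega>)) ^ (2 * p))"
        using s ev by (simp add: dd_def power_divide ennreal_mult[symmetric])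
    qed
    also have "\<dots> = ennreal (1 / s ^ p) * (\<integral>\<^sup>+\<omega>. ennreal ((?e (Z 0 \<omega>) (initvec Z m \<omega>)) ^ (2 * p)) \<partial>M)"
      by (intro nn_integral_cmult measurable_compose[OF _ measurable_ennreal] borel_measurable_power
          borel_measurable_diff clm Z_measurable initvec_measurable borel_measurable_const
          measurable_compose[OF Z_measurable mlm])
    also have "(\<integral>\<^sup>+\<omega>. ennreal ((?e (Z 0 \<omega>) (initvec Z m \<omega>)) ^ (2 * p)) \<partial>M)
        = (\<integral>\<^sup>+z. \<integral>\<^sup>+w. ennreal ((?e z w) ^ (2 * p)) \<partial>?Q \<partial>P)"
      unfolding initvec_eq_subvec
    proof (rule nn_integral_subvec[where G = "\<lambda>z w. ennreal ((?e z w) ^ (2 * p))"])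
      show "(\<lambda>(z, w). ennreal ((?e z w) ^ (2 * p))) \<in> borel_measurable (N \<Otimes>\<^sub>M (\<Pi>\<^sub>M l\<in>{1..m}. N))"
        unfolding case_prod_beta
        by (intro measurable_compose[OF _ measurable_ennreal] borel_measurable_power
          borel_measurable_diff clm measurable_fst measurable_snd borel_measurable_const
          measurable_compose[OF measurable_fst mlm])
    qed auto
    also have "\<dots> \<le> ennreal (57 * real m ^ p) * \<gamma>"
      unfolding \<gamma>_def \<mu> by (rule centred_loss_moment_bound[OF m1(1) h_meas h_int p])
    \<comment> \<open>The training size is enlarged to the sample size, in which the stability rates
      are stated.\<close>
    also have "\<dots> \<le> ennreal (57 * real n ^ p) * \<gamma>"
      using m1 by (intro mult_right_mono ennreal_leI mult_left_mono power_mono) auto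
    also have "ennreal (1 / s ^ p) * (ennreal (57 * real n ^ p) * \<gamma>) = ennreal 57 * (\<gamma> / ennreal (s ^ p / real n ^ p))"
    proof -
      have "\<gamma> / ennreal (s ^ p / real n ^ p) = \<gamma> * ennreal (real n ^ p / s ^ p)"
        using s n0 by (simp add: divide_ennreal_def inverse_ennreal)
      moreover have "ennreal (1 / s ^ p) * ennreal (57 * real n ^ p) = ennreal 57 * ennreal (real n ^ p / s ^ p)"
      proof -
        have "ennreal (1 / s ^ p) * ennreal (57 * real n ^ p) = ennreal (1 / s ^ p * (57 * real n ^ p))"
          using s by (intro ennreal_mult[symmetric]) auto
        also have "1 / s ^ p * (57 * real n ^ p) = 57 * (real n ^ p / s ^ p)" by simp
        also have "ennreal \<dots> = ennreal 57 * ennreal (real n ^ p / s ^ p)"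
          using s by (intro ennreal_mult) auto
        finally show ?thesis .
      qed
      ultimately show ?thesis by (simp add: mult_ac)
    qed
    finally show ?thesis by (simp add: mult_left_mono)
  qed
  have T: "(\<integral>\<^sup>+\<omega>. ennreal (T \<omega>) \<partial>M) \<le> ennreal 57 * (\<gamma> / ennreal (s ^ p / real n ^ p))" (is "_ \<le> ?b")
  proof -
    have "(\<integral>\<^sup>+\<omega>. ennreal (T \<omega>) \<partial>M)
        = (\<integral>\<^sup>+\<omega>. ennreal (1 / real n) * (\<Sum>j\<in>{1..k}. \<Sum>i\<in>F j. ennreal ((d \<omega> j i) ^ (2 * p))) \<partial>M)"
      unfolding T_def using ev by (intro nn_integral_cong) (simp add: sum_nonneg ennreal_mult[symmetric])
    also have "\<dots> = ennreal (1 / real n) * (\<integral>\<^sup>+\<omega>. (\<Sum>j\<in>{1..k}. \<Sum>i\<in>F j. ennreal ((d \<omega> j i) ^ (2 * p))) \<partial>M)"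
      by (intro nn_integral_cmult borel_measurable_sum measurable_compose[OF _ measurable_ennreal] borel_measurable_power dm)
    also have "(\<integral>\<^sup>+\<omega>. (\<Sum>j\<in>{1..k}. \<Sum>i\<in>F j. ennreal ((d \<omega> j i) ^ (2 * p))) \<partial>M)
        = (\<Sum>j\<in>{1..k}. \<integral>\<^sup>+\<omega>. (\<Sum>i\<in>F j. ennreal ((d \<omega> j i) ^ (2 * p))) \<partial>M)"
      by (intro nn_integral_sum borel_measurable_sum measurable_compose[OF _ measurable_ennreal] borel_measurable_power dm)
    also have "\<dots> = (\<Sum>j\<in>{1..k}. \<Sum>i\<in>F j. \<integral>\<^sup>+\<omega>. ennreal ((d \<omega> j i) ^ (2 * p)) \<partial>M)"
      by (intro sum.cong refl nn_integral_sum measurable_compose[OF _ measurable_ennreal] borel_measurable_power dm)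
    also have "\<dots> \<le> (\<Sum>j\<in>{1..k}. \<Sum>i\<in>F j. ?b)"
      by (intro sum_mono moment)
    also have "\<dots> = of_nat n * ?b"
    proof -
      have "(\<Sum>j\<in>{1..k}. of_nat (card (F j)) * ?b) = (\<Sum>j\<in>{1..k}. of_nat (n div k) * ?b)"
        by (intro sum.cong refl) (simp add: F.card_F)
      also have "\<dots> = of_nat (k * (n div k)) * ?b" by (simp add: mult.assoc)
      finally show ?thesis using nk by simp
    qed
    also have "ennreal (1 / real n) * (of_nat n * ?b) = ?b"
    proof -
      have "ennreal (1 / real n) * of_nat n = 1"
        using n0 by (simp add: ennreal_of_nat_eq_real_of_nat ennreal_mult[symmetric])
      then show ?thesis by (simp add: mult.assoc[symmetric])
    qed
    finally show ?thesis by (simp add: mult_left_mono)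
  qed
  have R: "(\<integral>\<^sup>+\<omega>. ennreal ((R \<omega>)\<^sup>2) \<partial>M) \<le> ennreal (4 / real n)"
    unfolding R_def by (rule off_diagonal_bound[OF F.folds_axioms vm v2])
  have T0: "0 \<le> T \<omega>" for \<omega>
    unfolding T_def using ev by (intro divide_nonneg_nonneg sum_nonneg) auto
  have "(\<integral>\<^sup>+\<omega>. ennreal (\<bar>within_fold_var Z n k B B' h \<omega> / s - 1\<bar> ^ p) \<partial>M)
    \<le> (\<integral>\<^sup>+\<omega>. ennreal (4 * \<eta>) + ennreal (64 / \<eta>\<^sup>2) *
        (ennreal (\<bar>A \<omega> - 1\<bar> ^ p) + ennreal ((R \<omega>)\<^sup>2) + ennreal (T \<omega>)) \<partial>M)"
  proof (rule nn_integral_mono)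
    fix \<omega>
    have "\<bar>within_fold_var Z n k B B' h \<omega> / s - 1\<bar> ^ p
        \<le> 4 * \<eta> + 64 / \<eta>\<^sup>2 * (\<bar>A \<omega> - 1\<bar> ^ p + (R \<omega>)\<^sup>2 + T \<omega>)"
      unfolding scaled A_def R_def T_def by (rule F.fold_form_error_bound[OF p \<eta>])
    then have "ennreal (\<bar>within_fold_var Z n k B B' h \<omega> / s - 1\<bar> ^ p)
        \<le> ennreal (4 * \<eta> + 64 / \<eta>\<^sup>2 * (\<bar>A \<omega> - 1\<bar> ^ p + (R \<omega>)\<^sup>2 + T \<omega>))" by (rule ennreal_leI)
    also have "\<dots> = ennreal (4 * \<eta>) + ennreal (64 / \<eta>\<^sup>2) *
        (ennreal (\<bar>A \<omega> - 1\<bar> ^ p) + ennreal ((R \<omega>)\<^sup>2) + ennreal (T \<omega>))"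
    proof -
      have "ennreal (a + c * (x + y + t)) = ennreal a + ennreal c * (ennreal x + ennreal y + ennreal t)"
        if "0 \<le> a" "0 \<le> c" "0 \<le> x" "0 \<le> y" "0 \<le> t" for a c x y t
        using that by (simp add: ennreal_plus ennreal_mult)
      note E = this
      show ?thesis by (rule E) (use \<eta> T0[of \<omega>] in auto)
    qed
    finally show "ennreal (\<bar>within_fold_var Z n k B B' h \<omega> / s - 1\<bar> ^ p)
      \<le> ennreal (4 * \<eta>) + ennreal (64 / \<eta>\<^sup>2) *
        (ennreal (\<bar>A \<omega> - 1\<bar> ^ p) + ennreal ((R \<omega>)\<^sup>2) + ennreal (T \<omega>))" .
  qed
  also have "\<dots> = ennreal (4 * \<eta>) + ennreal (64 / \<eta>\<^sup>2) *
      ((\<integral>\<^sup>+\<omega>. ennreal (\<bar>A \<omega> - 1\<bar> ^ p) \<partial>M) + (\<integral>\<^sup>+\<omega>. ennreal ((R \<omega>)\<^sup>2) \<partial>M) + (\<integral>\<^sup>+\<omega>. ennreal (T \<omega>) \<partial>M))"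
    by (simp add: nn_integral_add nn_integral_cmult emeasure_space_1)
  also have "\<dots> \<le> ennreal (4 * \<eta>) + ennreal (64 / \<eta>\<^sup>2) *
      ((\<integral>\<^sup>+\<omega>. ennreal (\<bar>A \<omega> - 1\<bar> ^ p) \<partial>M) + ennreal (4 / real n) + ennreal 57 * (\<gamma> / ennreal (s ^ p / real n ^ p)))"
    by (intro add_mono mult_left_mono R T order_refl) auto
  finally show "(\<integral>\<^sup>+\<omega>. ennreal (\<bar>within_fold_var Z n k B B' h \<omega> / s - 1\<bar> ^ p) \<partial>M)
      \<le> ennreal (4 * \<eta>) + ennreal (64 / \<eta>\<^sup>2) *
        ((\<integral>\<^sup>+\<omega>. ennreal (\<bar>(\<Sum>i\<in>{1..n}. (v (Z i \<omega>))\<^sup>2) / real n - 1\<bar> ^ p) \<partial>M) + ennreal (4 / real n)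
          + ennreal 57 * ((\<Sum>i\<in>{1..m}. \<integral>\<^sup>+\<omega>. ennreal ((centred_loss M N Z m h (Z 0 \<omega>) (initvec Z m \<omega>)
              - centred_loss M N Z m h (Z 0 \<omega>) (replaced Z m i \<omega>)) ^ (2 * p)) \<partial>M) / of_nat m / ennreal (s ^ p / real n ^ p)))"
    unfolding A_def \<gamma>_def .
qed

text \<open>\<open>C\<close> may depend on \<open>\<eta>\<close> in any way: for fixed
  \<open>\<eta>\<close> the product \<open>C * e n\<close> still vanishes in the limit, and only
  \<open>4 * \<eta>\<close> survives, which is arbitrarily small.\<close>

lemma tendsto_zero_ennreal_approxI:
  fixes X e :: "'a \<Rightarrow> ennreal"
  assumes e: "(e \<longlongrightarrow> 0) F"
    and X: "\<And>\<eta>::real. 0 < \<eta> \<Longrightarrow> \<eta> \<le> 1 \<Longrightarrow> \<exists>C::real. \<forall>\<^sub>F n in F. X n \<le> ennreal (4 * \<eta>) + ennreal C * e n"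
  shows "(X \<longlongrightarrow> 0) F"
proof (rule order_tendstoI)
  fix a :: ennreal assume "0 < a"
  then obtain x where x: "0 < x" "x < a" using dense by blast
  then obtain r where r: "x = ennreal r" "0 < r"
    by (cases x) (auto simp: ennreal_less_zero_iff)
  \<comment> \<open>Half of the target \<open>r\<close> is reserved for \<open>4 * \<eta>\<close>,
    the other half for \<open>C * e n\<close>.\<close>
  define \<eta> where "\<eta> = min 1 (r / 8)"
  have \<eta>: "0 < \<eta>" "\<eta> \<le> 1" "4 * \<eta> \<le> r / 2" using r by (auto simp: \<eta>_def)
  from X[OF \<eta>(1,2)] obtain C where C: "\<forall>\<^sub>F n in F. X n \<le> ennreal (4 * \<eta>) + ennreal C * e n" ..
  have "((\<lambda>n. ennreal C * e n) \<longlongrightarrow> ennreal C * 0) F"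
    by (rule ennreal_tendsto_cmult[OF _ e]) simp
  then have "\<forall>\<^sub>F n in F. ennreal C * e n < ennreal (r / 2)"
    by (rule order_tendstoD(2)) (use r in simp)
  with C show "\<forall>\<^sub>F n in F. X n < a"
  proof eventually_elim
    case (elim n)
    have "X n \<le> ennreal (r / 2) + ennreal (r / 2)"
      by (rule order_trans[OF elim(1)]) (use elim(2) \<eta> in \<open>intro add_mono ennreal_leI; simp\<close>)
    also have "\<dots> = x" using r by (simp add: ennreal_plus[symmetric] del: ennreal_plus)
    finally show ?case using x by simp
  qed
qed simp

theorem theorem4:
  fixes M :: "'w measure" and N :: "'z measure"
    and Z :: "nat \<Rightarrow> 'w \<Rightarrow> 'z"
    and S :: "nat set"
    and k m :: "nat \<Rightarrow> nat"
    and B B' :: "nat \<Rightarrow> nat \<Rightarrow> nat list"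
    and h :: "nat \<Rightarrow> 'z \<Rightarrow> (nat \<Rightarrow> 'z) \<Rightarrow> real"
    and Y :: "nat \<Rightarrow> 'w \<Rightarrow> real"
    and \<sigma>sq :: "nat \<Rightarrow> real"
  assumes M: "prob_space M"
    and indep: "prob_space.indep_vars M (\<lambda>_. N) Z UNIV"
    and ident: "\<And>i. distr M N (Z i) = distr M N (Z 0)"
    and S: "infinite S"
    and k: "\<And>n. n \<in> S \<Longrightarrow> 2 \<le> k n \<and> k n < n \<and> k n dvd n"
    and m: "\<And>n. m n = train_size n (k n)"
    and splits: "\<And>n. n \<in> S \<Longrightarrow> cv_splits n (k n) (B n) (B' n)"
    and h_meas: "\<And>n. n \<in> S \<Longrightarrow>
      (\<lambda>(z, w). h n z w) \<in> borel_measurable (N \<Otimes>\<^sub>M (\<Pi>\<^sub>M l\<in>{1..m n}. N))"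
    and h_int: "\<And>n. n \<in> S \<Longrightarrow> integrable M (\<lambda>\<omega>. h n (Z 0 \<omega>) (initvec Z (m n) \<omega>))"
    and Y: "\<And>n \<omega>. Y n \<omega> = mean_loss M Z (m n) (h n) (Z 0 \<omega>)"
    and \<sigma>sq: "\<And>n. \<sigma>sq n = prob_space.variance M (Y n)"
    and var_finite: "\<And>n. n \<in> S \<Longrightarrow> integrable M (\<lambda>\<omega>. (Y n \<omega>)\<^sup>2)"
    and var_pos: "\<And>n. n \<in> S \<Longrightarrow> 0 < \<sigma>sq n"
  shows
    "(((\<lambda>n. gamma_loss M N Z (m n) (h n) / ennreal (\<sigma>sq n / real n)) \<longlongrightarrow> 0) (along S)
      \<and> uniformly_integrable M S
          (\<lambda>n \<omega>. (Y n \<omega> - prob_space.expectation M (Y n))\<^sup>2 / \<sigma>sq n)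
      \<longrightarrow> tendsto_Lp 1 M
            (\<lambda>n \<omega>. within_fold_var Z n (k n) (B n) (B' n) (h n) \<omega> / \<sigma>sq n) (\<lambda>_. 1) (along S))
    \<and>
     (((\<lambda>n. (\<integral>\<^sup>+\<omega>. ennreal (((Y n \<omega> - prob_space.expectation M (Y n)) / sqrt (\<sigma>sq n)) ^ 4) \<partial>M)
            / of_nat n) \<longlongrightarrow> 0) (along S)
      \<and> ((\<lambda>n. gamma_4 M Z (m n) (centred_loss M N Z (m n) (h n))
            / ennreal ((\<sigma>sq n)\<^sup>2 / (real n)\<^sup>2)) \<longlongrightarrow> 0) (along S)
      \<longrightarrow> tendsto_Lp 2 M
            (\<lambda>n \<omega>. within_fold_var Z n (k n) (B n) (B' n) (h n) \<omega> / \<sigma>sq n) (\<lambda>_. 1) (along S))"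
proof -
  interpret iid_sample M N Z
    using M indep ident by (intro iid_sample.intro iid_sample_axioms.intro)
  let ?W = "\<lambda>n \<omega>. within_fold_var Z n (k n) (B n) (B' n) (h n) \<omega> / \<sigma>sq n"
  define v where "v n z = (mean_loss M Z (m n) (h n) z - expectation (Y n)) / sqrt (\<sigma>sq n)" for n z
  define \<gamma> where "\<gamma> p n = (\<Sum>i\<in>{1..m n}. \<integral>\<^sup>+\<omega>. ennreal ((centred_loss M N Z (m n) (h n) (Z 0 \<omega>) (initvec Z (m n) \<omega>)
      - centred_loss M N Z (m n) (h n) (Z 0 \<omega>) (replaced Z (m n) i \<omega>)) ^ (2 * p)) \<partial>M) / of_nat (m n)" for p n
  define A where "A n \<omega> = (\<Sum>i\<in>{1..n}. (v n (Z i \<omega>))\<^sup>2) / real n" for n \<omega>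
  have m1: "1 \<le> m n" if "n \<in> S" for n
  proof -
    have "n div k n < n" using k[OF that] by simp
    then show ?thesis unfolding m train_size_def by simp
  qed
  have mlm: "mean_loss M Z (m n) (h n) \<in> borel_measurable N" if "n \<in> S" for n
    by (rule mean_loss_measurable[OF m1 h_meas h_int]) (rule that)+
  have vm: "v n \<in> borel_measurable N" if "n \<in> S" for n
    unfolding v_def[abs_def] using mlm[OF that] by measurable
  have Y_eq: "Y n = (\<lambda>\<omega>. mean_loss M Z (m n) (h n) (Z 0 \<omega>))" for n using Y by auto
  have v_Y: "v n (Z 0 \<omega>) = (Y n \<omega> - expectation (Y n)) / sqrt (\<sigma>sq n)" for n \<omega>
    by (simp add: v_def Y)
  have v_sq: "(v n (Z 0 \<omega>))\<^sup>2 = (Y n \<omega> - expectation (Y n))\<^sup>2 / \<sigma>sq n" if "n \<in> S" for n \<omega>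
    using var_pos[OF that] by (simp add: v_Y power_divide)
  have v2: "integrable P (\<lambda>z. (v n z)\<^sup>2)" "(LINT z|P. (v n z)\<^sup>2) = 1" "(LINT z|P. v n z) = 0" if n: "n \<in> S" for n
  proof -
    have Ym: "Y n \<in> borel_measurable M" unfolding Y_eq using mlm[OF n] by measurable
    have iY: "integrable M (Y n)"
      by (rule square_integrable_imp_integrable[OF Ym var_finite[OF n]])
    have sq: "(Y n \<omega> - expectation (Y n))\<^sup>2 = (Y n \<omega>)\<^sup>2 - 2 * expectation (Y n) * Y n \<omega> + (expectation (Y n))\<^sup>2" for \<omega>
      by (simp add: power2_diff mult_ac)
    have iV: "integrable M (\<lambda>\<omega>. (Y n \<omega> - expectation (Y n))\<^sup>2)"
      unfolding sq using iY var_finite[OF n] by simp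
    have vm2: "(\<lambda>z. (v n z)\<^sup>2) \<in> borel_measurable N" using vm[OF n] by measurable
    show "integrable P (\<lambda>z. (v n z)\<^sup>2)"
      using iV by (simp add: integrable_Z[OF vm2, of 0, symmetric] v_sq[OF n])
    show "(LINT z|P. (v n z)\<^sup>2) = 1"
      using var_pos[OF n] by (simp add: integral_Z[OF vm2, of 0, symmetric] v_sq[OF n] \<sigma>sq[symmetric])
    show "(LINT z|P. v n z) = 0"
      using iY by (simp add: integral_Z[OF vm[OF n], of 0, symmetric] v_Y prob_space)
  qed
  have in_S: "\<forall>\<^sub>F n in along S. n \<in> S" by (simp add: eventually_inf_principal)
  have inv_n: "((\<lambda>n. ennreal (c / real n)) \<longlongrightarrow> 0) (along S)" for c
  proof (rule tendsto_mono[OF inf_le1])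
    have "(\<lambda>n. ennreal (c / real n)) \<longlonglongrightarrow> ennreal 0"
      by (intro tendsto_ennrealI lim_const_over_n)
    then show "(\<lambda>n. ennreal (c / real n)) \<longlonglongrightarrow> 0" by simp
  qed
  \<comment> \<open>Both assertions reduce to an \<open>L\<^sup>p\<close> law of large numbers for
    the squares together with the stability rate for the power \<open>2 * p\<close>.\<close>
  have reduction: "tendsto_Lp p M ?W (\<lambda>_. 1) (along S)"
    if p: "p = 1 \<or> p = 2"
      and A: "((\<lambda>n. \<integral>\<^sup>+\<omega>. ennreal (\<bar>A n \<omega> - 1\<bar> ^ p) \<partial>M) \<longlongrightarrow> 0) (along S)"
      and G: "((\<lambda>n. \<gamma> p n / ennreal (\<sigma>sq n ^ p / real n ^ p)) \<longlongrightarrow> 0) (along S)" for p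
  proof -
    define e where "e n = (\<integral>\<^sup>+\<omega>. ennreal (\<bar>A n \<omega> - 1\<bar> ^ p) \<partial>M) + ennreal (4 / real n)
      + ennreal 57 * (\<gamma> p n / ennreal (\<sigma>sq n ^ p / real n ^ p))" for n
    have "(e \<longlongrightarrow> 0 + 0 + ennreal 57 * 0) (along S)"
      unfolding e_def[abs_def] by (intro tendsto_add A inv_n ennreal_tendsto_cmult G) simp
    then have e: "(e \<longlongrightarrow> 0) (along S)" by simp
    have bound: "within_fold_var Z n (k n) (B n) (B' n) (h n) \<in> borel_measurable M"
      "0 < \<eta> \<Longrightarrow> \<eta> \<le> 1 \<Longrightarrow> (\<integral>\<^sup>+\<omega>. ennreal (\<bar>?W n \<omega> - 1\<bar> ^ p) \<partial>M)
        \<le> ennreal (4 * \<eta>) + ennreal (64 / \<eta>\<^sup>2) * e n" if n: "n \<in> S" for n \<eta>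
    proof -
      have kn: "2 \<le> k n" "k n < n" "k n dvd n" using k[OF n] by auto
      have mu: "expectation (Y n) = expectation (\<lambda>\<omega>. mean_loss M Z (m n) (h n) (Z 0 \<omega>))" by (simp add: Y_eq)
      note b = within_fold_var_bound[OF p _ _ kn m splits[OF n] h_meas[OF n] h_int[OF n] mu v_def var_pos[OF n] v2[OF n]]
      show "within_fold_var Z n (k n) (B n) (B' n) (h n) \<in> borel_measurable M"
        by (rule b(1)[of 1]) auto
      show "(\<integral>\<^sup>+\<omega>. ennreal (\<bar>?W n \<omega> - 1\<bar> ^ p) \<partial>M) \<le> ennreal (4 * \<eta>) + ennreal (64 / \<eta>\<^sup>2) * e n"
        if "0 < \<eta>" "\<eta> \<le> 1"
        using b(2)[OF that] unfolding e_def A_def \<gamma>_def .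
    qed
    have "((\<lambda>n. \<integral>\<^sup>+\<omega>. ennreal (\<bar>?W n \<omega> - 1\<bar> ^ p) \<partial>M) \<longlongrightarrow> 0) (along S)"
    proof (rule tendsto_zero_ennreal_approxI[OF e])
      fix \<eta> :: real assume "0 < \<eta>" "\<eta> \<le> 1"
      then show "\<exists>C. \<forall>\<^sub>F n in along S. (\<integral>\<^sup>+\<omega>. ennreal (\<bar>?W n \<omega> - 1\<bar> ^ p) \<partial>M) \<le> ennreal (4 * \<eta>) + ennreal C * e n"
        using bound(2) by (intro exI[of _ "64 / \<eta>\<^sup>2"] eventually_mono[OF in_S]) auto
    qed
    moreover have "\<forall>\<^sub>F n in along S. ?W n \<in> borel_measurable M"
      using in_S by eventually_elim (use bound(1) in measurable)
    ultimately show ?thesis unfolding tendsto_Lp_def by simp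
  qed
  have part1: "tendsto_Lp 1 M ?W (\<lambda>_. 1) (along S)"
    if G: "((\<lambda>n. gamma_loss M N Z (m n) (h n) / ennreal (\<sigma>sq n / real n)) \<longlongrightarrow> 0) (along S)"
      and UI: "uniformly_integrable M S (\<lambda>n \<omega>. (Y n \<omega> - expectation (Y n))\<^sup>2 / \<sigma>sq n)"
  proof (rule reduction)
    let ?X = "\<lambda>n \<omega>. (Y n \<omega> - expectation (Y n))\<^sup>2 / \<sigma>sq n"
    define tail where "tail a n = (\<integral>\<^sup>+\<omega>. ennreal (\<bar>?X n \<omega>\<bar> * indicator {a<..} \<bar>?X n \<omega>\<bar>) \<partial>M)" for a n
    have tail_P: "(\<integral>\<^sup>+z. ennreal ((v n z)\<^sup>2 * indicator {a<..} ((v n z)\<^sup>2)) \<partial>P) = tail a n" if n: "n \<in> S" for a n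
    proof -
      have meas: "(\<lambda>z. ennreal ((v n z)\<^sup>2 * indicator {a<..} ((v n z)\<^sup>2))) \<in> borel_measurable N"
        using vm[OF n] by measurable
      have "0 \<le> ?X n \<omega>" for \<omega> using var_pos[OF n] by simp
      then show ?thesis
        unfolding nn_integral_Z[OF meas, of 0, symmetric] tail_def v_sq[OF n] by (simp only: abs_of_nonneg)
    qed
    show "((\<lambda>n. \<integral>\<^sup>+\<omega>. ennreal (\<bar>A n \<omega> - 1\<bar> ^ 1) \<partial>M) \<longlongrightarrow> 0) (along S)"
    \<comment> \<open>The same limit argument again, now with \<open>e n = 1 / n\<close> and the
      constant \<open>a / \<eta>\<close>, where the truncation level \<open>a\<close> depends on
      \<open>\<eta>\<close> only.\<close>
    proof (rule tendsto_zero_ennreal_approxI[OF inv_n[of 1]])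
      fix \<eta> :: real assume \<eta>: "0 < \<eta>" "\<eta> \<le> 1"
      have "((\<lambda>a. SUP n\<in>S. tail a n) \<longlongrightarrow> 0) at_top"
        using UI unfolding uniformly_integrable_def tail_def by blast
      then have "\<forall>\<^sub>F a in at_top. (SUP n\<in>S. tail a n) < ennreal \<eta>"
        by (rule order_tendstoD(2)) (use \<eta> in simp)
      then have "\<forall>\<^sub>F a in at_top. (SUP n\<in>S. tail a n) < ennreal \<eta> \<and> 0 < a"
        using eventually_gt_at_top[of "0::real"] by eventually_elim auto
      \<comment> \<open>Uniform integrability gives one truncation level for all \<open>n\<close> in
        \<open>S\<close>, so \<open>a\<close> can be fixed before \<open>n\<close> grows.\<close>
      then obtain a where a: "(SUP n\<in>S. tail a n) < ennreal \<eta>" "0 < a"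
        using eventually_happens'[of at_top] by (metis (mono_tags, lifting) trivial_limit_at_top_linorder)
      have "(\<integral>\<^sup>+\<omega>. ennreal (\<bar>A n \<omega> - 1\<bar> ^ 1) \<partial>M) \<le> ennreal (4 * \<eta>) + ennreal (a / \<eta>) * ennreal (1 / real n)"
        if n: "n \<in> S" for n
      proof -
        have n0: "0 < n" using k[OF n] by simp
        have "tail a n \<le> ennreal \<eta>"
          using a(1) SUP_upper[OF n, of "tail a"] by (meson less_imp_le order_trans)
        have "(\<integral>\<^sup>+\<omega>. ennreal (\<bar>A n \<omega> - 1\<bar> ^ 1) \<partial>M) \<le> ennreal (\<eta> + a / (\<eta> * real n)) + 2 * tail a n"
          using diagonal_L1_bound[OF n0 vm[OF n] v2(1,2)[OF n] a(2) \<eta>(1)] unfolding tail_P[OF n] A_def by simp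
        also have "\<dots> \<le> ennreal (\<eta> + a / (\<eta> * real n)) + 2 * ennreal \<eta>"
          by (intro add_mono mult_left_mono \<open>tail a n \<le> ennreal \<eta>\<close>) auto
        also have "\<dots> = ennreal (\<eta> + a / (\<eta> * real n) + 2 * \<eta>)"
        proof -
          have "2 * ennreal \<eta> = ennreal (2 * \<eta>)" using \<eta> by (simp add: ennreal_mult)
          then show ?thesis using \<eta> a(2) by (simp only:) (intro ennreal_plus[symmetric]; simp)
        qed
        \<comment> \<open>The sum \<open>\<eta> + 2 * \<eta>\<close> is rounded up to the
          \<open>4 * \<eta>\<close> that the limit argument expects.\<close>
        also have "\<dots> \<le> ennreal (4 * \<eta> + a / \<eta> * (1 / real n))"
          using \<eta> by (intro ennreal_leI) simp
        also have "\<dots> = ennreal (4 * \<eta>) + ennreal (a / \<eta>) * ennreal (1 / real n)"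
          using \<eta> a by (subst ennreal_plus) (auto simp: ennreal_mult[symmetric])
        finally show ?thesis .
      qed
      then show "\<exists>C. \<forall>\<^sub>F n in along S. (\<integral>\<^sup>+\<omega>. ennreal (\<bar>A n \<omega> - 1\<bar> ^ 1) \<partial>M)
          \<le> ennreal (4 * \<eta>) + ennreal C * ennreal (1 / real n)"
        by (intro exI[of _ "a / \<eta>"] eventually_mono[OF in_S])
    qed
    show "((\<lambda>n. \<gamma> 1 n / ennreal (\<sigma>sq n ^ 1 / real n ^ 1)) \<longlongrightarrow> 0) (along S)"
      using G by (simp add: \<gamma>_def gamma_loss_def gamma_ms_def)
  qed simp
  have part2: "tendsto_Lp 2 M ?W (\<lambda>_. 1) (along S)"
    if V4: "((\<lambda>n. (\<integral>\<^sup>+\<omega>. ennreal (((Y n \<omega> - expectation (Y n)) / sqrt (\<sigma>sq n)) ^ 4) \<partial>M) / of_nat n) \<longlongrightarrow> 0) (along S)"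
      and G: "((\<lambda>n. gamma_4 M Z (m n) (centred_loss M N Z (m n) (h n))
            / ennreal ((\<sigma>sq n)\<^sup>2 / (real n)\<^sup>2)) \<longlongrightarrow> 0) (along S)"
  proof (rule reduction)
    show "((\<lambda>n. \<integral>\<^sup>+\<omega>. ennreal (\<bar>A n \<omega> - 1\<bar> ^ 2) \<partial>M) \<longlongrightarrow> 0) (along S)"
    \<comment> \<open>The assumption on the fourth moment is precisely that the variance bound for
      the average of squares tends to 0.\<close>
    proof (rule tendsto_sandwich[OF _ _ tendsto_const V4])
      show "\<forall>\<^sub>F n in along S. (\<integral>\<^sup>+\<omega>. ennreal (\<bar>A n \<omega> - 1\<bar> ^ 2) \<partial>M)
          \<le> (\<integral>\<^sup>+\<omega>. ennreal (((Y n \<omega> - expectation (Y n)) / sqrt (\<sigma>sq n)) ^ 4) \<partial>M) / of_nat n"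
        using in_S
      proof eventually_elim
        case (elim n)
        have n0: "0 < n" using k[OF elim] by simp
        have meas: "(\<lambda>z. ennreal (v n z ^ 4)) \<in> borel_measurable N" using vm[OF elim] by measurable
        show ?case
          using diagonal_L2_bound[OF n0 vm[OF elim] v2(1,2)[OF elim]]
          unfolding A_def nn_integral_Z[OF meas, of 0, symmetric] v_Y .
      qed
    qed simp
    show "((\<lambda>n. \<gamma> 2 n / ennreal ((\<sigma>sq n)\<^sup>2 / (real n)\<^sup>2)) \<longlongrightarrow> 0) (along S)"
      using G by (simp add: \<gamma>_def gamma_4_def)
  qed simp
  show ?thesis using part1 part2 by blast
qed

end
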